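(* Let $E\subset A\otimes B:=\mathbb{C}^4\otimes\mathbb{C}^4$ be a linear subspace. If there exists an irreducible polynomial $S$ of degree $2$ dividing all $3\times 3$ minors of $E$, then at least one of the following holds: (1) $E$ has bounded rank $3$; (2) up to changes of bases in $E$, $A$ and $B$, $E$ is either skew-symmetric, or has the form of a block diagonal matrix $\mathrm{diag}(X,X)$ where $$X=\begin{pmatrix} x_1 & x_2\\ x_2 & x_3\end{pmatrix}\quad\text{or}\quad X=\begin{pmatrix} x_1 & x_2\\ x_3 & x_4\end{pmatrix},$$ depending on the rank of $S$.
   Context: A linear subspace $E\subset\mathbb{C}^{a}\otimes\mathbb{C}^{b}$ of dimension $c$ is represented, after fixing a basis $e_1,\dots,e_c$ of $E$ and bases of the two factors, by the $a\times b$ matrix of linear forms in the variables $x_1,\dots,x_c$ corresponding to the general point $\sum_i x_ie_i$ of $E$. The minors of $E$ are the minors of this matrix, and are polynomials in $x_1,\dots,x_c$; divisibility is in $\mathbb{C}[x_1,\dots,x_c]$ (the zero polynomial is divisible by everything). $E$ has bounded rank $r$ if all matrices in $E$ have rank at most $r$. $E$ is skew-symmetric if its matrix of linear forms is skew-symmetric. The rank of $S$ is its rank as a quadratic form. *)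

theory Defs
  imports "HOL-Analysis.Analysis" "HOL-Library.Poly_Mapping"
begin

section \<open>Polynomials over the complex numbers in finitely many variables\<close>

text \<open>
  The polynomial ring with one variable for each element of the finite index type \<open>'n\<close>:
  a polynomial maps a monomial, given by its exponents, to its coefficient. Ring operations,
  divisibility and irreducibility are those of the library. Its instance of class \<open>idom\<close> needs
  a linear order on \<open>'n\<close>, that is, an ordering of the variables.
\<close>

type_synonym 'n cpoly = "('n \<Rightarrow>\<^sub>0 nat) \<Rightarrow>\<^sub>0 complex"

definition Const :: "complex \<Rightarrow> 'n cpoly"
  where "Const c = Poly_Mapping.single 0 c"

definition Var :: "'n \<Rightarrow> 'n cpoly"
  where "Var k = Poly_Mapping.single (Poly_Mapping.single k 1) 1"

text \<open>The zero polynomial gets degree 0.\<close>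

definition total_degree :: "'n::finite cpoly \<Rightarrow> nat"
  where "total_degree p =
    Max (insert 0 ((\<lambda>m. \<Sum>k\<in>UNIV. Poly_Mapping.lookup m k) ` Poly_Mapping.keys p))"

text \<open>
  The symmetric matrix \<open>G\<close> such that the degree 2 part of \<open>S\<close> is
  \<open>\<Sum>i j. G $ i $ j * x\<^sub>i * x\<^sub>j\<close>; an off-diagonal entry is half the coefficient of \<open>x\<^sub>i * x\<^sub>j\<close>.
\<close>

definition gram_matrix :: "'n::finite cpoly \<Rightarrow> complex^'n^'n"
  where "gram_matrix S = (\<chi> i j.
    (if i = j then 1 else 1 / 2) *
    Poly_Mapping.lookup S (Poly_Mapping.single i 1 + Poly_Mapping.single j 1))"

definition quadratic_rank :: "'n::finite cpoly \<Rightarrow> nat"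
  where "quadratic_rank S = rank (gram_matrix S)"


section \<open>Linear spaces of matrices\<close>

text \<open>
  Tensors in the product of \<open>\<complex>\<^sup>a\<close> and \<open>\<complex>\<^sup>b\<close> are identified with their \<open>a \<times> b\<close> coordinate matrices.
  The library makes \<open>complex^'b^'a\<close> a vector space over the reals only, so
  the complex structure is set up here.
\<close>

definition matrix_scale :: "complex \<Rightarrow> complex^'b^'a \<Rightarrow> complex^'b^'a"
  where "matrix_scale c M = (\<chi> i j. c * M $ i $ j)"

global_interpretation cmat: vector_space "matrix_scale :: complex \<Rightarrow> complex^'b^'a \<Rightarrow> complex^'b^'a"
  by standard (simp_all add: matrix_scale_def vec_eq_iff algebra_simps)

definition is_basis :: "('n \<Rightarrow> complex^'b^'a) \<Rightarrow> (complex^'b^'a) set \<Rightarrow> bool"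
  where "is_basis e E \<longleftrightarrow> inj e \<and> cmat.independent (range e) \<and> cmat.span (range e) = E"

definition bounded_rank :: "nat \<Rightarrow> (complex^'b^'a) set \<Rightarrow> bool"
  where "bounded_rank r E \<longleftrightarrow> (\<forall>M\<in>E. rank M \<le> r)"

text \<open>The matrix of the general point \<open>\<Sum>k. x\<^sub>k * e k\<close>.\<close>

definition linear_form_matrix :: "('n::finite \<Rightarrow> complex^'b^'a) \<Rightarrow> 'n cpoly^'b^'a"
  where "linear_form_matrix e = (\<chi> i j. \<Sum>k\<in>UNIV. Const (e k $ i $ j) * Var k)"

text \<open>
  The minor on the rows \<open>r\<close> and the columns \<open>s\<close>, intended for injective \<open>r\<close> and \<open>s\<close>.
  Reordering the rows or the columns changes only its sign.
\<close>

definition minor :: "('k::finite \<Rightarrow> 'a) \<Rightarrow> ('k \<Rightarrow> 'b) \<Rightarrow> 'c::comm_ring_1^'b^'a \<Rightarrow> 'c"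
  where "minor r s M = det (\<chi> i j. M $ r i $ s j)"

definition skew_symmetric :: "'c::ring_1^'a^'a \<Rightarrow> bool"
  where "skew_symmetric M \<longleftrightarrow> transpose M = - M"

text \<open>
  \<open>L\<close> is the matrix of linear forms of \<open>E\<close> with respect to some basis \<open>f\<close> of \<open>E\<close>, after changes of
  bases in the row space (by \<open>P\<close>) and in the column space (by \<open>Q\<close>).
\<close>

definition has_matrix_up_to_bases :: "(complex^'b^'a) set \<Rightarrow> 'n::finite cpoly^'b^'a \<Rightarrow> bool"
  where "has_matrix_up_to_bases E L \<longleftrightarrow>
    (\<exists>(f :: 'n \<Rightarrow> complex^'b^'a) (P :: complex^'a^'a) (Q :: complex^'b^'b).
      is_basis f E \<and> invertible P \<and> invertible Q \<and>
      linear_form_matrix (\<lambda>k. P ** f k ** Q) = L)"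

definition block_diag :: "'c::zero^2^2 \<Rightarrow> 'c^2^2 \<Rightarrow> 'c^4^4"
  where "block_diag X Y = vector
    [vector [X $ 1 $ 1, X $ 1 $ 2, 0, 0],
     vector [X $ 2 $ 1, X $ 2 $ 2, 0, 0],
     vector [0, 0, Y $ 1 $ 1, Y $ 1 $ 2],
     vector [0, 0, Y $ 2 $ 1, Y $ 2 $ 2]]"

lemma vector_4 [simp]:
  "(vector [w, x, y, z] :: 'c::zero^4) $ 1 = w"
  "(vector [w, x, y, z] :: 'c^4) $ 2 = x"
  "(vector [w, x, y, z] :: 'c^4) $ 3 = y"
  "(vector [w, x, y, z] :: 'c^4) $ 4 = z"
  by (simp_all add: vector_def)

definition generic_symmetric_2x2 :: "3 cpoly^2^2"
  where "generic_symmetric_2x2 = vector [vector [Var 1, Var 2], vector [Var 2, Var 3]]"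

definition generic_2x2 :: "4 cpoly^2^2"
  where "generic_2x2 = vector [vector [Var 1, Var 2], vector [Var 3, Var 4]]"

end

theory Submission
  imports Defs "HOL-Computational_Algebra.Polynomial"
begin

text \<open>
  Let \<open>A\<close> be the matrix of linear forms and suppose \<open>det A \<noteq> 0\<close>. The adjugate of \<open>A\<close> is \<open>S\<close> times
  a matrix \<open>N\<close> of linear forms, so \<open>A N = R I\<close> for a quadratic form \<open>R\<close> with \<open>det A = S R\<close>
  and \<open>S det N = R\<^sup>3\<close>. Linear forms are prime, so \<open>R\<close> is not a product of two of them.

  After normalizing \<open>A\<close> to \<open>I\<close> at a point, \<open>A N = R I\<close> says that \<open>A = t I + D\<close> with \<open>t\<close> a linear form and
  \<open>D\<^sup>2\<close> scalar: a Clifford module of dimension 4. As \<open>R\<close> is not a product, \<open>D\<close> contains two anticommuting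
  involutions, which in a suitable basis are \<open>I \<otimes> \<sigma>\<^sub>z\<close> and \<open>I \<otimes> \<sigma>\<^sub>x\<close>. What anticommutes with both
  is \<open>T \<otimes> \<epsilon>\<close> with \<open>T\<close> a \<open>2 \<times> 2\<close> matrix and \<open>\<epsilon>\<close> the skew one, and \<open>T\<^sup>2\<close> is scalar. Hence either every
  \<open>T\<close> has trace 0, and multiplication by \<open>\<epsilon> \<otimes> I\<close> makes \<open>A\<close> skew-symmetric, or every \<open>T\<close> is
  scalar, and \<open>A = diag(X, X)\<close> with \<open>X\<close> generic. The space of the \<open>diag(X, X)\<close> with \<open>X\<close> symmetric
  is covered by the skew-symmetric case \<open>T = 0\<close>.
\<close>

section \<open>Polynomials and substitution\<close>

lemma Const_0 [simp]: "Const 0 = 0"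
  and Const_1 [simp]: "Const 1 = 1"
  and Const_add: "Const (a + b) = Const a + Const b"
  and Const_mult: "Const (a * b) = Const a * Const b"
  by (simp_all add: Const_def single_add mult_single)

lemma cpoly_eq_sum_single:
  "p = (\<Sum>m\<in>Poly_Mapping.keys p. Poly_Mapping.single m (Poly_Mapping.lookup p m))"
  by (rule poly_mapping_eqI) (simp add: lookup_sum lookup_single when_def in_keys_iff)

lemma Var_power: "Var k ^ j = Poly_Mapping.single (Poly_Mapping.single k j) 1"
  by (induction j) (simp_all add: Var_def mult_single flip: single_add)

lemma sum_single_lookup:
  fixes m :: "'n::finite \<Rightarrow>\<^sub>0 nat"
  shows "(\<Sum>k\<in>UNIV. Poly_Mapping.single k (Poly_Mapping.lookup m k)) = m"
  by (rule poly_mapping_eqI) (simp add: lookup_sum lookup_single when_def)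

lemma single_eq_Const_mult_prod:
  fixes m :: "'n::finite \<Rightarrow>\<^sub>0 nat"
  shows "Poly_Mapping.single m c = Const c * (\<Prod>k\<in>UNIV. Var k ^ Poly_Mapping.lookup m k)"
proof -
  have "(\<Prod>k\<in>A. Var k ^ Poly_Mapping.lookup m k)
      = Poly_Mapping.single (\<Sum>k\<in>A. Poly_Mapping.single k (Poly_Mapping.lookup m k)) 1"
    if "finite A" for A
    using that by induction (simp_all add: Var_power mult_single)
  from this[of UNIV] show ?thesis
    by (simp add: sum_single_lookup Const_def mult_single)
qed

text \<open>Constants and variables generate the ring, so identities of homomorphisms and
  congruences need checking on these only.\<close>

lemma cpoly_induct [case_names Const Var add mult]:
  fixes p :: "'n::finite cpoly"
  assumes C: "\<And>c. P (Const c)" and V: "\<And>k. P (Var k)"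
    and A: "\<And>p q. P p \<Longrightarrow> P q \<Longrightarrow> P (p + q)"
    and M: "\<And>p q. P p \<Longrightarrow> P q \<Longrightarrow> P (p * q)"
  shows "P p"
proof -
  have pow: "P (Var k ^ j)" for k j
    by (induction j) (use C[of 1] V M in auto)
  have prd: "P (\<Prod>k\<in>B. Var k ^ Poly_Mapping.lookup m k)" if "finite B" for B m
    using that by induction (use C[of 1] pow M in auto)
  have sgl: "P (Poly_Mapping.single m c)" for m c
    unfolding single_eq_Const_mult_prod by (intro M C prd) simp
  have "P (\<Sum>m\<in>B. Poly_Mapping.single m (Poly_Mapping.lookup p m))" if "finite B" for B
    using that by induction (use C[of 0] sgl A in auto)
  then show ?thesis
    by (subst cpoly_eq_sum_single) simp
qed

section \<open>Substitution homomorphisms\<close>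

definition insertion :: "(complex \<Rightarrow> 'r::comm_ring_1) \<Rightarrow> ('n::finite \<Rightarrow> 'r) \<Rightarrow> 'n cpoly \<Rightarrow> 'r"
  where "insertion h f p = (\<Sum>m\<in>Poly_Mapping.keys p.
    h (Poly_Mapping.lookup p m) * (\<Prod>k\<in>UNIV. f k ^ Poly_Mapping.lookup m k))"

text \<open>A coefficient homomorphism \<open>h\<close> makes \<open>insertion h f\<close> a ring
  homomorphism. One construction thus serves evaluation at a point, substitution of polynomials,
  restriction to a line and the grading.\<close>

locale coefficient_hom =
  fixes h :: "complex \<Rightarrow> 'r::comm_ring_1"
  assumes h_1: "h 1 = 1"
    and h_add: "h (a + b) = h a + h b"
    and h_mult: "h (a * b) = h a * h b"
begin

lemma h_0: "h 0 = 0"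
  using h_add[of 0 0] by simp

lemma insertion_superset:
  assumes "finite B" "Poly_Mapping.keys p \<subseteq> B"
  shows "insertion h f p = (\<Sum>m\<in>B. h (Poly_Mapping.lookup p m) * (\<Prod>k\<in>UNIV. f k ^ Poly_Mapping.lookup m k))"
  unfolding insertion_def
  by (rule sum.mono_neutral_left) (use assms in \<open>auto simp: in_keys_iff h_0\<close>)

lemma insertion_single:
  "insertion h f (Poly_Mapping.single m c) = h c * (\<Prod>k\<in>UNIV. f k ^ Poly_Mapping.lookup m k)"
  by (subst insertion_superset[of "{m}"]) auto

lemma insertion_Const [simp]: "insertion h f (Const c) = h c"
  unfolding Const_def insertion_single by simp

lemma insertion_0 [simp]: "insertion h f 0 = 0"
  by (simp add: insertion_def)

lemma insertion_1 [simp]: "insertion h f 1 = 1"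
  using insertion_Const[of f 1] by (simp add: h_1)

lemma insertion_Var [simp]: "insertion h f (Var k) = f k"
proof -
  have "(\<Prod>i\<in>UNIV. f i ^ Poly_Mapping.lookup (Poly_Mapping.single k 1) i) = (\<Prod>i\<in>UNIV. if i = k then f i else 1)"
    by (rule prod.cong) (auto simp: lookup_single when_def)
  then show ?thesis
    unfolding Var_def insertion_single by (simp add: h_1)
qed

lemma insertion_add [simp]: "insertion h f (p + q) = insertion h f p + insertion h f q"
proof -
  let ?B = "Poly_Mapping.keys p \<union> Poly_Mapping.keys q"
  show ?thesis
    using keys_add[of p q]
    by (simp add: insertion_superset[of ?B] lookup_add h_add distrib_right sum.distrib)
qed

lemma insertion_sum: "insertion h f (sum g B) = (\<Sum>x\<in>B. insertion h f (g x))"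
  by (induction B rule: infinite_finite_induct) simp_all

lemma insertion_mult_single:
  "insertion h f (Poly_Mapping.single m c * Poly_Mapping.single m' c')
    = insertion h f (Poly_Mapping.single m c) * insertion h f (Poly_Mapping.single m' c')"
  unfolding mult_single insertion_single
  by (simp add: lookup_add power_add prod.distrib h_mult)

lemma insertion_mult [simp]: "insertion h f (p * q) = insertion h f p * insertion h f q"
proof -
  have "p * q = (\<Sum>m\<in>Poly_Mapping.keys p. \<Sum>m'\<in>Poly_Mapping.keys q.
      Poly_Mapping.single m (Poly_Mapping.lookup p m) * Poly_Mapping.single m' (Poly_Mapping.lookup q m'))"
    by (subst (1) cpoly_eq_sum_single[of p], subst (1) cpoly_eq_sum_single[of q]) (simp add: sum_product)
  then have "insertion h f (p * q) = (\<Sum>m\<in>Poly_Mapping.keys p. \<Sum>m'\<in>Poly_Mapping.keys q.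
      insertion h f (Poly_Mapping.single m (Poly_Mapping.lookup p m)) * insertion h f (Poly_Mapping.single m' (Poly_Mapping.lookup q m')))"
    by (simp add: insertion_sum insertion_mult_single)
  also have "\<dots> = insertion h f p * insertion h f q"
    unfolding insertion_single by (simp add: insertion_def sum_product)
  finally show ?thesis .
qed

lemma insertion_uminus [simp]: "insertion h f (- p) = - insertion h f p"
  using insertion_add[of f p "- p"] by (simp add: eq_neg_iff_add_eq_0 add.commute)

lemma insertion_diff [simp]: "insertion h f (p - q) = insertion h f p - insertion h f q"
  using insertion_add[of f p "- q"] by simp

lemma insertion_prod: "insertion h f (prod g B) = (\<Prod>x\<in>B. insertion h f (g x))"
  by (induction B rule: infinite_finite_induct) simp_all

lemma insertion_det: "insertion h f (det A) = det (\<chi> i j. insertion h f (A $ i $ j))"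
  unfolding det_def by (simp add: insertion_sum insertion_prod) (rule sum.cong, auto simp: sign_def)

end

interpretation id_hom: coefficient_hom "\<lambda>c. c"
  by standard simp_all

interpretation Const_hom: coefficient_hom "Const :: complex \<Rightarrow> 'n cpoly"
  by standard (simp_all add: Const_add Const_mult)

interpretation constant_poly_hom: coefficient_hom "\<lambda>c. [:c:]"
  by standard simp_all

interpretation grading_hom: coefficient_hom "\<lambda>c. [:Const c:] :: 'n cpoly poly"
  by standard (simp_all add: Const_add Const_mult)

abbreviation eval :: "('n::finite \<Rightarrow> complex) \<Rightarrow> 'n cpoly \<Rightarrow> complex"
  where "eval \<equiv> insertion (\<lambda>c. c)"

lemma poly_insertion_line:
  "poly (insertion (\<lambda>c. [:c:]) (\<lambda>k. [:u k, v k:]) p) t = eval (\<lambda>k. u k + t * v k) p"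
  by (induction p rule: cpoly_induct) simp_all

text \<open>Restrict to the line through \<open>u\<close> and \<open>w\<close>, on which \<open>p\<close> is not the zero polynomial.\<close>

lemma eval_cancel:
  assumes eq: "\<And>x. eval x p * eval x q = eval x p * eval x r" and u: "eval u p \<noteq> 0"
  shows "eval w q = eval w r"
proof -
  let ?L = "insertion (\<lambda>c. [:c:]) (\<lambda>k. [:u k, w k - u k:])"
  have "?L p * ?L q = ?L p * ?L r"
    by (rule poly_eq_poly_eq_iff[THEN iffD1]) (simp add: fun_eq_iff poly_insertion_line eq)
  moreover have "?L p \<noteq> 0"
    using u poly_insertion_line[of u "\<lambda>k. w k - u k" p 0] by auto
  ultimately have "?L q = ?L r"
    by simp
  then show ?thesis
    using poly_insertion_line[of u "\<lambda>k. w k - u k" _ 1] by (metis (no_types, lifting) diff_add_cancel add.commute mult_1 ext)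
qed

section \<open>Homogeneous polynomials\<close>

definition monomial_degree :: "('n::finite \<Rightarrow>\<^sub>0 nat) \<Rightarrow> nat"
  where "monomial_degree m = (\<Sum>k\<in>UNIV. Poly_Mapping.lookup m k)"

text \<open>The zero polynomial is homogeneous of every degree, so the homogeneous polynomials of
  one degree are closed under sums.\<close>

definition homogeneous :: "nat \<Rightarrow> 'n::finite cpoly \<Rightarrow> bool"
  where "homogeneous d p \<longleftrightarrow> (\<forall>m\<in>Poly_Mapping.keys p. monomial_degree m = d)"

text \<open>The coefficient of degree \<open>d\<close> of \<open>grading p\<close> is the homogeneous part of degree \<open>d\<close> of \<open>p\<close>.\<close>

definition grading :: "'n::finite cpoly \<Rightarrow> 'n cpoly poly"
  where "grading = insertion (\<lambda>c. [:Const c:]) (\<lambda>k. monom (Var k) 1)"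

lemma grading_simps [simp]:
  "grading (p + q) = grading p + grading q" "grading (p * q) = grading p * grading q"
  "grading (p - q) = grading p - grading q" "grading 1 = 1" "grading (- p) = - grading p"
  "grading (Const c) = [:Const c:]" "grading (Var k) = monom (Var k) 1" "grading 0 = 0"
  by (simp_all add: grading_def)

lemma grading_sum: "grading (sum f B) = (\<Sum>x\<in>B. grading (f x))"
  by (simp add: grading_def grading_hom.insertion_sum)

lemma monom_prod: "finite B \<Longrightarrow> (\<Prod>k\<in>B. monom (f k) (d k)) = monom (\<Prod>k\<in>B. f k) (\<Sum>k\<in>B. d k)"
  by (induction B rule: finite_induct) (simp_all add: mult_monom)

lemma grading_eq:
  "grading p = (\<Sum>m\<in>Poly_Mapping.keys p. monom (Poly_Mapping.single m (Poly_Mapping.lookup p m)) (monomial_degree m))"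
proof -
  have "[:Const c:] * (\<Prod>k\<in>UNIV. monom (Var k) 1 ^ Poly_Mapping.lookup m k)
     = monom (Poly_Mapping.single m c) (monomial_degree m)" for m :: "'a \<Rightarrow>\<^sub>0 nat" and c
    unfolding single_eq_Const_mult_prod
    by (simp add: monom_power monom_prod monomial_degree_def mult_monom smult_monom)
  then show ?thesis
    unfolding grading_def insertion_def by simp
qed

lemma lookup_coeff_grading:
  "Poly_Mapping.lookup (coeff (grading p) d) m = (if monomial_degree m = d then Poly_Mapping.lookup p m else 0)"
proof -
  have "Poly_Mapping.lookup (coeff (grading p) d) m = (\<Sum>m'\<in>Poly_Mapping.keys p.
     if m' = m then (if monomial_degree m = d then Poly_Mapping.lookup p m else 0) else 0)"
    unfolding grading_eq coeff_sum lookup_sum coeff_monom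
    by (rule sum.cong) (auto simp: lookup_single when_def)
  then show ?thesis
    by (simp add: in_keys_iff)
qed

lemma grading_eq_monomD:
  assumes "grading p = monom c d"
  shows "homogeneous d p"
  unfolding homogeneous_def
proof
  fix m assume m: "m \<in> Poly_Mapping.keys p"
  then have "Poly_Mapping.lookup (coeff (grading p) (monomial_degree m)) m \<noteq> 0"
    by (simp add: lookup_coeff_grading in_keys_iff)
  then show "monomial_degree m = d"
    by (auto simp: assms split: if_splits)
qed

lemma homogeneous_iff_grading: "homogeneous d p \<longleftrightarrow> grading p = monom p d"
proof
  assume "homogeneous d p"
  then have "grading p = (\<Sum>m\<in>Poly_Mapping.keys p. monom (Poly_Mapping.single m (Poly_Mapping.lookup p m)) d)"
    unfolding grading_eq homogeneous_def by simp
  then show "grading p = monom p d"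
    by (subst (2) cpoly_eq_sum_single) (simp add: monom_sum)
qed (rule grading_eq_monomD)

text \<open>Moves questions about total degree to univariate polynomials over an integral domain,
  where the degrees of nonzero factors add. For \<open>p = 0\<close> both sides are 0.\<close>

lemma degree_grading: "degree (grading p) = total_degree p"
proof (rule antisym)
  show "degree (grading p) \<le> total_degree p"
  proof (rule degree_le, intro allI impI)
    fix d assume d: "total_degree p < d"
    show "coeff (grading p) d = 0"
    proof (rule poly_mapping_eqI)
      fix m
      have "m \<in> Poly_Mapping.keys p \<Longrightarrow> monomial_degree m \<le> total_degree p"
        unfolding total_degree_def monomial_degree_def by (intro Max_ge) auto
      then show "Poly_Mapping.lookup (coeff (grading p) d) m = Poly_Mapping.lookup 0 m"
        using d by (cases "m \<in> Poly_Mapping.keys p") (auto simp: lookup_coeff_grading in_keys_iff)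
    qed
  qed
next
  have "total_degree p \<in> insert 0 (monomial_degree ` Poly_Mapping.keys p)"
    unfolding total_degree_def monomial_degree_def by (intro Max_in) auto
  moreover have "monomial_degree m \<le> degree (grading p)" if "m \<in> Poly_Mapping.keys p" for m
  proof (rule le_degree)
    have "Poly_Mapping.lookup (coeff (grading p) (monomial_degree m)) m \<noteq> 0"
      using that by (simp add: lookup_coeff_grading in_keys_iff)
    then show "coeff (grading p) (monomial_degree m) \<noteq> 0"
      by auto
  qed
  ultimately show "total_degree p \<le> degree (grading p)"
    by auto
qed

text \<open>Induction on \<open>d\<close>: for \<open>d > 0\<close> one of the factors has constant
  coefficient 0, since there are no zero divisors, and the variable can be removed from it. For
  \<open>d = 0\<close> both factors are constant.\<close>

lemma monom_factor:
  fixes a b :: "'a::idom poly"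
  assumes "a * b = monom c d" "c \<noteq> 0"
  shows "\<exists>x i. a = monom x i"
  using assms(1)
proof (induction d arbitrary: a b)
  case 0
  then have "degree a + degree b = 0"
    using assms(2) by (metis degree_monom_eq degree_mult_eq monom_eq_0_iff mult_zero_left mult_zero_right)
  then have "degree a = 0" by simp
  then show ?case
    by (metis degree_eq_zeroE monom_0)
next
  case (Suc d)
  have "coeff a 0 * coeff b 0 = 0"
    by (simp add: Suc.prems flip: coeff_mult_0)
  then consider "coeff a 0 = 0" | "coeff b 0 = 0" by auto
  then show ?case
  proof cases
    case 1
    obtain a' where a': "a = pCons 0 a'"
      using 1 by (cases a) auto
    then have "a' * b = monom c d"
      using Suc.prems by (simp add: monom_Suc)
    from Suc.IH[OF this] show ?thesis
      unfolding a' by (metis monom_Suc)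
  next
    case 2
    obtain b' where b': "b = pCons 0 b'"
      using 2 by (cases b) auto
    then have "a * b' = monom c d"
      using Suc.prems by (simp add: monom_Suc)
    from Suc.IH[OF this] show ?thesis .
  qed
qed

text \<open>\<open>grading\<close> turns a factorization of a homogeneous polynomial into one of a
  monomial, whose factors are again monomials.\<close>

lemma homogeneous_mult_imp_left:
  fixes p q :: "'n::{finite,linorder} cpoly"
  assumes "homogeneous d (p * q)" "p * q \<noteq> 0"
  shows "homogeneous (total_degree p) p"
proof -
  have "grading p * grading q = monom (p * q) d"
    using assms(1) by (simp add: homogeneous_iff_grading)
  then obtain x i where p: "grading p = monom x i"
    using monom_factor assms(2) by blast
  moreover have "x \<noteq> 0"
    using assms(2) \<open>grading p * grading q = _\<close> p by auto
  ultimately have "i = total_degree p"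
    using degree_grading[of p] by (simp add: degree_monom_eq)
  with p show ?thesis
    using grading_eq_monomD by blast
qed

lemma total_degree_mult:
  fixes p q :: "'n::{finite,linorder} cpoly"
  assumes "p * q \<noteq> 0"
  shows "total_degree (p * q) = total_degree p + total_degree q"
proof -
  have "grading r \<noteq> 0" if "r \<noteq> 0" for r :: "'n cpoly"
    using that grading_eq_monomD[of r 0] poly_mapping_eqI[of r 0] lookup_coeff_grading[of r]
    by (metis coeff_0 lookup_zero)
  then show ?thesis
    using assms by (simp add: degree_mult_eq flip: degree_grading)
qed

lemma homogeneous_total_degree:
  assumes "homogeneous d p" "p \<noteq> 0"
  shows "total_degree p = d"
  using assms degree_grading[of p] by (simp add: homogeneous_iff_grading degree_monom_eq)

section \<open>Monomials of degree one and two\<close>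

lemma monomial_degree_add: "monomial_degree (m + m') = monomial_degree m + monomial_degree m'"
  by (simp add: monomial_degree_def lookup_add sum.distrib)

lemma monomial_degree_single [simp]: "monomial_degree (Poly_Mapping.single k j) = j"
  by (simp add: monomial_degree_def lookup_single when_def)

lemma monomial_degree_SucE:
  assumes "monomial_degree m = Suc d"
  obtains k m' where "m = Poly_Mapping.single k 1 + m'" "monomial_degree m' = d"
proof -
  obtain k where k: "Poly_Mapping.lookup m k \<noteq> 0"
    using assms unfolding monomial_degree_def by (metis sum.neutral nat.distinct(1))
  have m: "m = Poly_Mapping.single k 1 + (m - Poly_Mapping.single k 1)"
    by (rule poly_mapping_eqI) (use k in \<open>auto simp: lookup_add lookup_minus lookup_single when_def\<close>)
  have "monomial_degree (m - Poly_Mapping.single k 1) = d"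
    using assms by (subst (asm) m) (simp add: monomial_degree_add)
  with m that show thesis by blast
qed

lemma monomial_degree_0D: "monomial_degree m = 0 \<Longrightarrow> m = 0"
  by (rule poly_mapping_eqI) (simp add: monomial_degree_def)

lemma monomial_degree_1E:
  assumes "monomial_degree m = 1"
  obtains k where "m = Poly_Mapping.single k 1"
  using assms monomial_degree_SucE[of m 0] monomial_degree_0D by (metis One_nat_def add.right_neutral)

lemma monomial_degree_2E:
  assumes "monomial_degree m = 2"
  obtains i j where "m = Poly_Mapping.single i 1 + Poly_Mapping.single j 1"
  using assms monomial_degree_SucE[of m 1] monomial_degree_1E by (metis numeral_2_eq_2 One_nat_def)

lemma single_add_single_eq_iff:
  "Poly_Mapping.single a (1::nat) + Poly_Mapping.single b 1 = Poly_Mapping.single i 1 + Poly_Mapping.single j 1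
    \<longleftrightarrow> a = i \<and> b = j \<or> a = j \<and> b = i" (is "?L \<longleftrightarrow> ?R")
proof
  assume ?L
  then have "Poly_Mapping.lookup (Poly_Mapping.single a (1::nat) + Poly_Mapping.single b 1) x
      = Poly_Mapping.lookup (Poly_Mapping.single i 1 + Poly_Mapping.single j 1) x" for x
    by simp
  from this[of a] this[of b] this[of i] this[of j] show ?R
    by (auto simp: lookup_add lookup_single when_def split: if_splits)
qed (auto simp: add.commute)

section \<open>Linear and quadratic forms\<close>

definition linear_form :: "('n::finite \<Rightarrow> complex) \<Rightarrow> 'n cpoly"
  where "linear_form a = (\<Sum>k\<in>UNIV. Const (a k) * Var k)"

definition quadratic_form :: "('n::finite \<Rightarrow> 'n \<Rightarrow> complex) \<Rightarrow> 'n cpoly"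
  where "quadratic_form c = (\<Sum>i\<in>UNIV. \<Sum>j\<in>UNIV. Const (c i j) * (Var i * Var j))"

lemma lookup_linear_form:
  "Poly_Mapping.lookup (linear_form a) m = (\<Sum>k\<in>UNIV. if m = Poly_Mapping.single k 1 then a k else 0)"
  unfolding linear_form_def lookup_sum
  by (rule sum.cong) (auto simp: Const_def Var_def mult_single lookup_single when_def)

lemma lookup_quadratic_form:
  "Poly_Mapping.lookup (quadratic_form c) m
    = (\<Sum>i\<in>UNIV. \<Sum>j\<in>UNIV. if m = Poly_Mapping.single i 1 + Poly_Mapping.single j 1 then c i j else 0)"
  unfolding quadratic_form_def lookup_sum
  by (intro sum.cong) (auto simp: Const_def Var_def mult_single lookup_single when_def)

lemma single_1_eq_iff: "Poly_Mapping.single a (1::nat) = Poly_Mapping.single b 1 \<longleftrightarrow> a = b"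
  by (metis lookup_single_eq lookup_single_not_eq zero_neq_one)

lemma lookup_linear_form_single [simp]:
  "Poly_Mapping.lookup (linear_form a) (Poly_Mapping.single k 1) = a k"
  unfolding lookup_linear_form single_1_eq_iff by simp

lemma lookup_quadratic_form_single:
  "Poly_Mapping.lookup (quadratic_form c) (Poly_Mapping.single a 1 + Poly_Mapping.single b 1)
    = (if a = b then c a a else c a b + c b a)"
proof -
  \<comment> \<open>The two orders of the pair are summed separately; for \<open>a = b\<close> the
    second sum is suppressed, so that the diagonal term is counted once.\<close>
  have "(if a = i \<and> b = j \<or> a = j \<and> b = i then c i j else 0)
     = (if i = a then if j = b then c i j else 0 else 0)
        + (if i = b then if j = a then (if a = b then 0 else c i j) else 0 else 0)" for i j
    by auto
  then show ?thesis
    unfolding lookup_quadratic_form single_add_single_eq_iff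
    by (simp add: sum.distrib if_distrib[of "\<lambda>x. sum x _"] sum.If_cases) 
qed

lemma linear_form_eqI:
  assumes "homogeneous 1 p"
  shows "p = linear_form (\<lambda>k. Poly_Mapping.lookup p (Poly_Mapping.single k 1))"
proof (rule poly_mapping_eqI)
  fix m
  show "Poly_Mapping.lookup p m = Poly_Mapping.lookup (linear_form (\<lambda>k. Poly_Mapping.lookup p (Poly_Mapping.single k 1))) m"
  proof (cases "monomial_degree m = 1")
    case True
    then show ?thesis
      using monomial_degree_1E by (metis lookup_linear_form_single)
  next
    case False
    then have "m \<noteq> Poly_Mapping.single k 1" for k
      by auto
    then show ?thesis
      using False assms by (auto simp: lookup_linear_form homogeneous_def in_keys_iff)
  qed
qed

text \<open>The halves in \<open>gram_matrix\<close> make up for the two orders in which a mixed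
  monomial occurs in the double sum.\<close>

lemma quadratic_form_gram_matrix:
  assumes "homogeneous 2 p"
  shows "p = quadratic_form (\<lambda>i j. gram_matrix p $ i $ j)"
proof (rule poly_mapping_eqI)
  fix m
  show "Poly_Mapping.lookup p m = Poly_Mapping.lookup (quadratic_form (\<lambda>i j. gram_matrix p $ i $ j)) m"
  proof (cases "monomial_degree m = 2")
    case True
    then obtain i j where "m = Poly_Mapping.single i 1 + Poly_Mapping.single j 1"
      using monomial_degree_2E by blast
    then show ?thesis
      by (simp add: lookup_quadratic_form_single gram_matrix_def add.commute del: One_nat_def)
  next
    case False
    then have "m \<noteq> Poly_Mapping.single i 1 + Poly_Mapping.single j 1" for i j
      by (auto simp: monomial_degree_add)
    then show ?thesis
      using False assms by (auto simp: lookup_quadratic_form homogeneous_def in_keys_iff)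
  qed
qed

lemma eval_linear_form: "eval u (linear_form a) = (\<Sum>k\<in>UNIV. a k * u k)"
  by (simp add: linear_form_def id_hom.insertion_sum)

lemma eval_quadratic_form: "eval u (quadratic_form c) = (\<Sum>i\<in>UNIV. \<Sum>j\<in>UNIV. c i j * (u i * u j))"
  by (simp add: quadratic_form_def id_hom.insertion_sum)

lemma homogeneous_linear_form: "homogeneous 1 (linear_form a)"
proof -
  have "grading (linear_form a) = monom (linear_form a) 1"
    unfolding linear_form_def grading_sum by (simp add: smult_monom monom_sum)
  then show ?thesis by (rule grading_eq_monomD)
qed

text \<open>The form \<open>linear_form a\<close> generates the kernel of the substitution that solves it for \<open>Var k\<close>.\<close>

lemma prime_linear_form:
  fixes a :: "'n::{finite,linorder} \<Rightarrow> complex"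
  assumes k: "a k \<noteq> 0"
  shows "prime_elem (linear_form a)"
proof -
  let ?l = "linear_form a"
  define f where "f = (\<lambda>i. if i = k then Var k - Const (1 / a k) * ?l else Var i)"
  define \<pi> where "\<pi> = insertion Const f"
  have hom: "\<pi> (p * q) = \<pi> p * \<pi> q" "\<pi> (p + q) = \<pi> p + \<pi> q" "\<pi> 1 = 1" for p q
    by (simp_all add: \<pi>_def)
  have "\<pi> ?l = (\<Sum>i\<in>UNIV. Const (a i) * f i)"
    by (simp add: linear_form_def \<pi>_def Const_hom.insertion_sum)
  also have "\<dots> = (\<Sum>i\<in>UNIV. Const (a i) * Var i - (if i = k then Const (a k) * (Const (1 / a k) * ?l) else 0))"
    by (rule sum.cong) (auto simp: f_def algebra_simps)
  also have "\<dots> = ?l - Const (a k * (1 / a k)) * ?l"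
    unfolding Const_mult by (simp add: sum_subtractf mult.assoc linear_form_def[of a, symmetric])
  finally have l0: "\<pi> ?l = 0"
    using k by (simp flip: Const_mult)
  \<comment> \<open>Modulo \<open>?l\<close> the substitution changes nothing: this holds for the
    generators and is preserved by sums and products.\<close>
  have cong: "?l dvd p - \<pi> p" for p
  proof (induction p rule: cpoly_induct)
    case (mult p q)
    have "p * q - \<pi> (p * q) = (p - \<pi> p) * q + \<pi> p * (q - \<pi> q)"
      by (simp add: hom algebra_simps)
    then show ?case
      using mult by (metis dvd_add dvd_mult dvd_mult2)
  next
    case (add p q)
    have "p + q - \<pi> (p + q) = (p - \<pi> p) + (q - \<pi> q)"
      by (simp add: hom)
    then show ?case
      using add by (metis dvd_add)
  qed (auto simp: \<pi>_def f_def)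
  have dvd_iff: "?l dvd p \<longleftrightarrow> \<pi> p = 0" for p
    using cong[of p] by (auto simp: hom l0 elim!: dvdE)
  \<comment> \<open>Divisibility by \<open>?l\<close> is membership in the kernel of
    \<open>\<pi>\<close>, a homomorphism into an integral domain, so the kernel is prime;
    \<open>\<pi> 1 = 1\<close> keeps \<open>?l\<close> from being a unit.\<close>
  show ?thesis
  proof (rule prime_elemI)
    show "?l \<noteq> 0"
      using k lookup_linear_form_single[of a k] by auto
  qed (simp_all add: dvd_iff hom)
qed

text \<open>Write \<open>p * q = s * d\<close>. The prime \<open>p\<close> divides \<open>d\<close>,
  as it does not divide \<open>s\<close>, and can be cancelled.\<close>

lemma dvd_prime_mult_cancel:
  fixes s :: "'a::idom"
  assumes "prime_elem p" "s dvd p * q" "\<not> p dvd s"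
  shows "s dvd q"
proof -
  obtain d where d: "p * q = s * d" using assms(2) by (elim dvdE)
  then have "p dvd d"
    using assms(1,3) by (metis dvd_triv_left prime_elem_dvd_mult_iff)
  then obtain e where "d = p * e" by (elim dvdE)
  then have "q = s * e"
    using d assms(1) by (simp add: mult.left_commute prime_elem_not_zeroI)
  then show ?thesis by simp
qed

text \<open>A linear divisor of \<open>S\<close> would split it into two factors of degree 1,
  neither of them a unit. So the linear forms, being prime, cancel one after another until
  \<open>S\<close> divides 1.\<close>

lemma irreducible_quadric_not_dvd_linear_forms:
  fixes S :: "'n::{finite,linorder} cpoly"
  assumes S: "irreducible S" "total_degree S = 2"
    and dvd: "S dvd (linear_form a * linear_form b) ^ j"
    and nz: "linear_form a * linear_form b \<noteq> 0"
  shows False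
proof -
  have ndvd: "\<not> linear_form c dvd S" if c: "linear_form c \<noteq> 0" for c
  proof
    assume "linear_form c dvd S"
    then obtain u where u: "S = linear_form c * u" by (elim dvdE)
    have S0: "S \<noteq> 0" using S(1) by auto
    have dl: "total_degree (linear_form c) = 1"
      using homogeneous_total_degree[OF homogeneous_linear_form c] .
    then have du: "total_degree u = 1"
      using S(2) S0 total_degree_mult[of "linear_form c" u] u by simp
    have nunit: "\<not> p dvd 1" if "total_degree p = 1" for p :: "'n cpoly"
    proof
      assume "p dvd 1"
      then obtain q where "1 = p * q" by (elim dvdE)
      then have "total_degree p + total_degree q = total_degree (1 :: 'n cpoly)"
        by (metis total_degree_mult zero_neq_one)
      then show False
        using that by (simp flip: degree_grading)
    qed
    from irreducibleD[OF S(1) u] nunit dl du show False by blast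
  qed
  have prm: "prime_elem (linear_form c)" if c: "linear_form c \<noteq> 0" for c :: "'n \<Rightarrow> complex"
  proof -
    have "\<exists>k. c k \<noteq> 0"
      using c by (rule contrapos_np) (simp add: linear_form_def)
    then show ?thesis using prime_linear_form by blast
  qed
  have ab: "linear_form a \<noteq> 0" "linear_form b \<noteq> 0" using nz by auto
  have "S dvd 1"
    using dvd
  proof (induction j)
    case (Suc j)
    then have "S dvd linear_form a * (linear_form b * (linear_form a * linear_form b) ^ j)"
      by (simp add: mult.assoc)
    then have "S dvd linear_form b * (linear_form a * linear_form b) ^ j"
      by (rule dvd_prime_mult_cancel[OF prm[OF ab(1)] _ ndvd[OF ab(1)]])
    then have "S dvd (linear_form a * linear_form b) ^ j"
      by (rule dvd_prime_mult_cancel[OF prm[OF ab(2)] _ ndvd[OF ab(2)]])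
    then show ?case by (rule Suc.IH)
  qed simp
  then show False
    using S(1) by (simp add: irreducible_not_unit)
qed

lemma homogeneous_mult: "homogeneous d p \<Longrightarrow> homogeneous d' q \<Longrightarrow> homogeneous (d + d') (p * q)"
  by (rule grading_eq_monomD) (simp add: homogeneous_iff_grading mult_monom)

lemma homogeneous_diff: "homogeneous d p \<Longrightarrow> homogeneous d q \<Longrightarrow> homogeneous d (p - q)"
  by (rule grading_eq_monomD) (simp add: homogeneous_iff_grading diff_monom)

lemma homogeneous_sum: "(\<And>x. x \<in> B \<Longrightarrow> homogeneous d (f x)) \<Longrightarrow> homogeneous d (sum f B)"
  by (rule grading_eq_monomD[of _ "sum f B"]) (simp add: homogeneous_iff_grading grading_sum monom_sum)

lemma gram_matrix_symmetric: "gram_matrix p $ i $ j = gram_matrix p $ j $ i"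
  by (simp add: gram_matrix_def add.commute)

text \<open>Polarization: the values on combinations of two coordinate vectors determine all entries
  of the Gram matrix.\<close>

lemma homogeneous_2_eq_0I:
  fixes p :: "'n::finite cpoly"
  assumes p: "homogeneous 2 p" and z: "\<And>u. eval u p = 0"
  shows "p = 0"
proof -
  let ?G = "\<lambda>i j. gram_matrix p $ i $ j"
  have ev: "(\<Sum>i\<in>UNIV. \<Sum>j\<in>UNIV. ?G i j * (u i * u j)) = 0" for u
    using z[of u] by (subst (asm) quadratic_form_gram_matrix[OF p]) (simp add: eval_quadratic_form)
  have pol: "x * (x * ?G a a) + x * (y * ?G a b) + (y * (x * ?G b a) + y * (y * ?G b b)) = 0" for a b x y
  proof -
    have "?G i j * ((x * of_bool (i = a) + y * of_bool (i = b)) * (x * of_bool (j = a) + y * of_bool (j = b)))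
      = (if j = a then (if i = a then x * (x * ?G a a) else 0) else 0)
      + (if j = b then (if i = a then x * (y * ?G a b) else 0) else 0)
      + (if j = a then (if i = b then y * (x * ?G b a) else 0) else 0)
      + (if j = b then (if i = b then y * (y * ?G b b) else 0) else 0)" for i j
      by (auto simp: algebra_simps)
    then show ?thesis
      using ev[of "\<lambda>i. x * of_bool (i = a) + y * of_bool (i = b)"]
      by (simp add: sum.distrib add.assoc)
  qed
  have d: "?G a a = 0" for a
    using pol[of 1 a 0 a] by simp
  have "?G a b = 0" for a b
    using pol[of 1 a 1 b] d[of a] d[of b] gram_matrix_symmetric[of p a b] by simp
  then show ?thesis
    by (subst quadratic_form_gram_matrix[OF p]) (simp add: quadratic_form_def)
qed

text \<open>A kernel vector is orthogonal to every vector for the associated bilinear form, so both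
  the cross terms and the value at \<open>v\<close> vanish.\<close>

lemma eval_add_kernel:
  assumes p: "homogeneous 2 p" and v: "gram_matrix p *v v = 0"
  shows "eval (($) (u + v)) p = eval (($) u) p"
proof -
  let ?G = "\<lambda>i j. gram_matrix p $ i $ j"
  have Gv: "(\<Sum>j\<in>UNIV. ?G i j * v $ j) = 0" for i
    using v by (simp add: vec_eq_iff matrix_vector_mult_def)
  have Gv': "(\<Sum>i\<in>UNIV. ?G i j * v $ i) = 0" for j
    using Gv[of j] by (simp add: gram_matrix_symmetric[of p _ j])
  have "eval (($) (u + v)) p = (\<Sum>i\<in>UNIV. \<Sum>j\<in>UNIV. ?G i j * ((u + v) $ i * (u + v) $ j))"
    by (subst quadratic_form_gram_matrix[OF p]) (simp add: eval_quadratic_form)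
  also have "\<dots> = (\<Sum>i\<in>UNIV. \<Sum>j\<in>UNIV. ?G i j * (u $ i * u $ j))
      + (\<Sum>j\<in>UNIV. u $ j * (\<Sum>i\<in>UNIV. ?G i j * v $ i))
      + (\<Sum>i\<in>UNIV. (u $ i + v $ i) * (\<Sum>j\<in>UNIV. ?G i j * v $ j))"
    unfolding sum_distrib_left
    by (subst sum.swap[of "\<lambda>j i. u $ j * _ i j"])
       (simp add: algebra_simps sum.distrib)
  also have "\<dots> = eval (($) u) p"
    unfolding Gv Gv' by (subst (2) quadratic_form_gram_matrix[OF p]) (simp add: eval_quadratic_form)
  finally show ?thesis .
qed

section \<open>The matrix factorization\<close>

lemma det_4:
  "det (A::'a::comm_ring_1^4^4) =
    A$1$1 * det (\<chi> i j. A $ (if i = 1 then 2 else if i = 2 then 3 else 4) $ (if j = 1 then 2 else if j = 2 then 3 else 4) :: 'a^3^3)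
  - A$1$2 * det (\<chi> i j. A $ (if i = 1 then 2 else if i = 2 then 3 else 4) $ (if j = 1 then 1 else if j = 2 then 3 else 4) :: 'a^3^3)
  + A$1$3 * det (\<chi> i j. A $ (if i = 1 then 2 else if i = 2 then 3 else 4) $ (if j = 1 then 1 else if j = 2 then 2 else 4) :: 'a^3^3)
  - A$1$4 * det (\<chi> i j. A $ (if i = 1 then 2 else if i = 2 then 3 else 4) $ (if j = 1 then 1 else if j = 2 then 2 else 3) :: 'a^3^3)"
proof -
  \<comment> \<open>Permutations are split by peeling off the points 1, 2 and 3 in turn, which
    leaves explicit products of transpositions.\<close>
  have f1: "finite {2::4, 3, 4}" "1 \<notin> {2::4, 3, 4}"
    by auto
  have f2: "finite {3::4, 4}" "2 \<notin> {3::4, 4}"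
    by auto
  have f3: "finite {4::4}" "3 \<notin> {4::4}"
    by auto
  show ?thesis
    unfolding det_3
    unfolding det_def UNIV_4
    unfolding sum_over_permutations_insert[OF f1]
    unfolding sum_over_permutations_insert[OF f2]
    unfolding sum_over_permutations_insert[OF f3]
    unfolding permutes_sing
    by (simp add: sign_swap_id permutation_swap_id permutation_compose sign_compose sign_id swap_id_eq algebra_simps)
qed

text \<open>The usual transposed cofactor matrix. A cofactor is written as the determinant of
  \<open>A\<close> with row \<open>i\<close> replaced by a unit vector, so that linearity in that
  row applies.\<close>

definition adjugate :: "'a::comm_ring_1^'n^'n \<Rightarrow> 'a^'n^'n"
  where "adjugate A = (\<chi> j i. det (\<chi> k. if k = i then axis j 1 else A $ k))"

text \<open>Linearity in row \<open>i\<close> assembles the unit vectors into row \<open>k\<close>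
  of \<open>A\<close>; for \<open>k \<noteq> i\<close> the resulting matrix has two equal
  rows.\<close>

lemma matrix_mul_adjugate: "A ** adjugate A = mat (det A)"
proof -
  have "(A ** adjugate A) $ k $ i = mat (det A) $ k $ i" for k i
  proof -
    have "(A ** adjugate A) $ k $ i
        = (\<Sum>j\<in>UNIV. det (\<chi> l. if l = i then A $ k $ j *s axis j 1 else A $ l))"
      unfolding adjugate_def matrix_matrix_mult_def by (simp add: det_row_mul)
    also have "\<dots> = det (\<chi> l. if l = i then A $ k else A $ l)"
      by (subst det_linear_row_sum[symmetric]) (simp_all only: finite_class.finite_UNIV basis_expansion)
    also have "\<dots> = (if k = i then det A else 0)"
    proof (cases "k = i")
      case True
      then have "(\<chi> l. if l = i then A $ k else A $ l) = A"
        by (simp add: vec_eq_iff)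
      with True show ?thesis by simp
    next
      case False
      then show ?thesis
        by (simp, intro det_identical_rows[of k i]) (auto simp: row_def)
    qed
    finally show ?thesis by (simp add: mat_def)
  qed
  then show ?thesis by (simp add: vec_eq_iff)
qed

text \<open>The increasing enumeration of the indices other than \<open>i\<close>.\<close>

definition skip :: "4 \<Rightarrow> 3 \<Rightarrow> 4"
  where "skip i k =
    (if i = 1 then (if k = 1 then 2 else if k = 2 then 3 else 4)
     else if i = 2 then (if k = 1 then 1 else if k = 2 then 3 else 4)
     else if i = 3 then (if k = 1 then 1 else if k = 2 then 2 else 4)
     else (if k = 1 then 1 else if k = 2 then 2 else 3))"

lemma inj_skip: "inj (skip i)"
  unfolding inj_def skip_def by (simp add: forall_3)

text \<open>Links the adjugate to the minors that \<open>S\<close> divides. The cofactor sign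
  \<open>(-1)^(i+j)\<close> is the product of the parity signs of the two indices.\<close>

lemma adjugate_eq_minor:
  fixes A :: "'a::comm_ring_1^4^4"
  shows "adjugate A $ j $ i =
    (if i \<in> {1, 3} then 1 else - 1) * (if j \<in> {1, 3} then 1 else - 1) * minor (skip i) (skip j) A"
proof -
  have "\<forall>i j. adjugate A $ j $ i =
    (if i \<in> {1, 3} then 1 else - 1) * (if j \<in> {1, 3} then 1 else - 1) * minor (skip i) (skip j) A"
    unfolding adjugate_def minor_def skip_def
    by (simp add: forall_4 det_4 det_3 axis_def algebra_simps)
  then show ?thesis by blast
qed

section \<open>Minors of matrices of linear forms\<close>

lemma det_monom:
  fixes A :: "'a::comm_ring_1^'k^'k"
  shows "det (\<chi> i j. monom (A $ i $ j) 1) = monom (det A) CARD('k)"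
proof -
  have "of_int (sign p) * monom c d = monom (of_int (sign p) * c) d" for p :: "'k \<Rightarrow> 'k" and c :: 'a and d
    by (auto simp: sign_def minus_monom)
  then show ?thesis
    unfolding det_def by (simp add: monom_prod monom_sum)
qed

lemma linear_form_matrix_nth: "linear_form_matrix e $ i $ j = linear_form (\<lambda>k. e k $ i $ j)"
  by (simp add: linear_form_matrix_def linear_form_def)

text \<open>The grading commutes with determinants and multiplies each linear entry by the variable,
  hence the determinant by its \<open>CARD('k)\<close>-th power.\<close>

lemma homogeneous_minor:
  fixes r s :: "'k::finite \<Rightarrow> _"
  shows "homogeneous CARD('k) (minor r s (linear_form_matrix e))"
proof (rule grading_eq_monomD)
  have "grading (minor r s (linear_form_matrix e))
      = det (\<chi> i j. grading (linear_form_matrix e $ r i $ s j))"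
    unfolding minor_def grading_def by (simp add: grading_hom.insertion_det)
  also have "\<dots> = det (\<chi> i j. monom ((\<chi> i j. linear_form_matrix e $ r i $ s j) $ i $ j) 1)"
    by (simp add: homogeneous_linear_form[unfolded homogeneous_iff_grading] linear_form_matrix_nth)
  finally show "grading (minor r s (linear_form_matrix e)) = monom (minor r s (linear_form_matrix e)) CARD('k)"
    unfolding det_monom minor_def .
qed

text \<open>Divide the adjugate by \<open>S\<close>: the quotient \<open>N\<close> satisfies
  \<open>S * (A N) = det A * I\<close>, and cancelling \<open>S\<close> makes \<open>A N\<close>
  scalar. Its entries have degree \<open>3 - 2 = 1\<close>, so \<open>R\<close> has degree
  2.\<close>

lemma linear_matrix_factorization:
  fixes e :: "'n::{finite,linorder} \<Rightarrow> complex^4^4" and S :: "'n cpoly"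
  assumes S: "total_degree S = 2"
    and dvd: "\<And>(r :: 3 \<Rightarrow> 4) (s :: 3 \<Rightarrow> 4). inj r \<Longrightarrow> inj s \<Longrightarrow> S dvd minor r s (linear_form_matrix e)"
    and det: "det (linear_form_matrix e) \<noteq> 0"
  obtains n :: "'n \<Rightarrow> complex^4^4" and R
  where "linear_form_matrix e ** linear_form_matrix n = mat R"
    and "det (linear_form_matrix e) = S * R" and "homogeneous 2 S" and "homogeneous 2 R" and "R \<noteq> 0"
proof -
  let ?A = "linear_form_matrix e"
  have "\<forall>i j. \<exists>q. adjugate ?A $ i $ j = S * q"
    unfolding adjugate_eq_minor using dvd[OF inj_skip inj_skip] by (metis dvdE dvd_mult)
  then obtain Q where Q: "\<And>i j. adjugate ?A $ i $ j = S * Q i j"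
    by metis
  have hom3: "homogeneous 3 (adjugate ?A $ i $ j)" for i j
    unfolding adjugate_eq_minor
    using homogeneous_minor[of "skip j" "skip i" e] by (auto simp: homogeneous_def in_keys_iff)
  define N where "N = (\<chi> i j. Q i j)"
  have S0: "S \<noteq> 0"
    using S by (auto simp: total_degree_def)
  have SN: "S * (?A ** N) $ k $ i = mat (det ?A) $ k $ i" for k i
    unfolding matrix_mul_adjugate[symmetric] N_def matrix_matrix_mult_def
    by (simp add: Q sum_distrib_left mult.left_commute)
  define R where "R = (?A ** N) $ 1 $ 1"
  have dR: "det ?A = S * R"
    using SN[of 1 1] by (simp add: R_def mat_def)
  have AN: "?A ** N = mat R"
  proof -
    have "(?A ** N) $ k $ i = mat R $ k $ i" for k i
      using SN[of k i] S0 by (auto simp: mat_def dR)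
    then show ?thesis by (simp add: vec_eq_iff)
  qed
  have R0: "R \<noteq> 0" using dR det by auto
  \<comment> \<open>Some cofactor is nonzero, so \<open>S\<close>, so far only of degree 2, is
    homogeneous as a factor of a nonzero cubic form.\<close>
  have "\<exists>i j. Q i j \<noteq> 0"
  proof (rule ccontr)
    assume "\<nexists>i j. Q i j \<noteq> 0"
    then have "R = 0"
      by (simp add: R_def N_def matrix_matrix_mult_def)
    with R0 show False by simp
  qed
  then obtain i j where "Q i j \<noteq> 0" by blast
  then have hS: "homogeneous 2 S"
    using homogeneous_mult_imp_left[of 3 S "Q i j"] hom3[of i j] S0 S unfolding Q by simp
  have hQ: "homogeneous 1 (Q i j)" for i j
  proof (cases "Q i j = 0")
    case False
    then have nz: "S * Q i j \<noteq> 0" using S0 by simp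
    have "homogeneous (total_degree (Q i j)) (Q i j)"
      using homogeneous_mult_imp_left[of 3 "Q i j" S] hom3[of i j] nz unfolding Q by (simp add: mult.commute)
    moreover have "total_degree S + total_degree (Q i j) = 3"
      using total_degree_mult[OF nz] homogeneous_total_degree[of 3 "S * Q i j"] hom3[of i j] nz
      unfolding Q by simp
    ultimately show ?thesis using S by simp
  qed (simp add: homogeneous_def)
  define n where "n = (\<lambda>k. \<chi> i j. Poly_Mapping.lookup (Q i j) (Poly_Mapping.single k 1))"
  have "N = linear_form_matrix n"
    using linear_form_eqI[OF hQ] by (simp add: vec_eq_iff N_def linear_form_matrix_nth n_def)
  moreover have "homogeneous 2 R"
    unfolding R_def matrix_matrix_mult_def
    using homogeneous_mult[of 1 _ 1, OF homogeneous_linear_form hQ]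
    by (simp add: N_def linear_form_matrix_nth) (intro homogeneous_sum, simp add: numeral_2_eq_2)
  ultimately show thesis
    using that AN dR hS R0 by blast
qed

text \<open>Determinants in \<open>A N = R I\<close> give \<open>S * det N = R ^ 3\<close>; were
  \<open>R\<close> a product of two linear forms, the irreducible quadric \<open>S\<close> would
  divide a power of that product.\<close>

lemma factorized_form_not_product:
  fixes e n :: "'n::{finite,linorder} \<Rightarrow> complex^4^4" and S :: "'n cpoly"
  assumes S: "irreducible S" "total_degree S = 2"
    and AN: "linear_form_matrix e ** linear_form_matrix n = mat R"
    and d: "det (linear_form_matrix e) = S * R" and R: "R \<noteq> 0" "homogeneous 2 R"
  shows "\<not> (\<forall>u. eval u R = (\<Sum>k\<in>UNIV. a k * u k) * (\<Sum>k\<in>UNIV. b k * u k))"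
proof
  assume ev: "\<forall>u. eval u R = (\<Sum>k\<in>UNIV. a k * u k) * (\<Sum>k\<in>UNIV. b k * u k)"
  \<comment> \<open>Quadratic forms with equal values are equal, so the factorization of values is
    one of polynomials.\<close>
  have "homogeneous 2 (linear_form a * linear_form b)"
    using homogeneous_mult[OF homogeneous_linear_form homogeneous_linear_form, of a b] by (simp add: numeral_2_eq_2)
  then have "R - linear_form a * linear_form b = 0"
    using R(2) by (intro homogeneous_2_eq_0I homogeneous_diff) (simp_all add: ev eval_linear_form)
  then have Rab: "R = linear_form a * linear_form b" by simp
  have "S * R * det (linear_form_matrix n) = det (mat R :: 'n cpoly^4^4)"
    by (simp add: d det_mul flip: AN)
  also have "\<dots> = R ^ 4"
    by (subst det_diagonal) (simp_all add: mat_def)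
  finally have "R * (S * det (linear_form_matrix n)) = R * R ^ 3"
    by (simp add: eval_nat_numeral ac_simps)
  then have "S * det (linear_form_matrix n) = R ^ 3"
    using R(1) by (metis mult_left_cancel)
  then have "S dvd (linear_form a * linear_form b) ^ 3"
    unfolding Rab by (metis dvd_triv_left)
  then show False
    using irreducible_quadric_not_dvd_linear_forms[OF S] R(1) unfolding Rab by blast
qed

lemma rank_eq_CARD:
  fixes A :: "'a::field^'n^'n"
  assumes "\<And>v. A *v v = 0 \<Longrightarrow> v = 0"
  shows "rank A = CARD('n)"
proof -
  have "vec.span (rows A) = UNIV"
    using assms by (metis matrix_left_invertible_ker matrix_left_invertible_span_rows_gen)
  then have "vec.dim (rows A) = vec.dim (UNIV :: ('a^'n) set)"
    by (metis vec.dim_span)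
  then show ?thesis
    by (simp add: row_rank_def_gen vec_dim_card card_cart_basis)
qed

section \<open>Clifford modules\<close>

lemma matrix_scale_mult_left: "matrix_scale c A ** B = matrix_scale c (A ** B)"
  by (simp add: matrix_scale_def matrix_matrix_mult_def vec_eq_iff sum_distrib_left mult.assoc)

lemma matrix_scale_mult_right: "A ** matrix_scale c B = matrix_scale c (A ** B)"
  by (simp add: matrix_scale_def matrix_matrix_mult_def vec_eq_iff sum_distrib_left ac_simps)

lemma matrix_scale_nth: "matrix_scale c A $ i $ j = c * A $ i $ j"
  by (simp add: matrix_scale_def)

lemma matrix_scale_mat: "matrix_scale c (mat d) = mat (c * d)"
  by (simp add: matrix_scale_def mat_def vec_eq_iff)

lemma mat_add: "mat (a + b) = mat a + (mat b :: 'a::monoid_add^'n^'n)"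
  and mat_diff: "mat (a' - b') = mat a' - (mat b' :: 'b::group_add^'n^'n)"
  by (simp_all add: mat_def vec_eq_iff)

lemma mat_eq_scale: "mat c = matrix_scale c (mat 1)"
  by (simp add: matrix_scale_mat)

lemma matrix_diff_mult_left: "(A - B) ** C = A ** C - B ** (C :: 'a::ring_1^'n^'m)"
  and matrix_diff_mult_right: "C' ** (A' - B') = C' ** A' - C' ** (B' :: 'a::ring_1^'n^'m)"
  by (simp_all add: matrix_matrix_mult_def vec_eq_iff sum_subtractf algebra_simps)

lemma matrix_add_mult_left: "(A + B) ** C = A ** C + B ** (C :: 'a::semiring_1^'n^'m)"
  by (simp add: matrix_matrix_mult_def vec_eq_iff sum.distrib distrib_right)

lemma matrix_minus_mult_left: "(- A) ** C = - (A ** (C :: 'a::ring_1^'n^'m))"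
  and matrix_minus_mult_right: "C' ** (- A') = - (C' ** (A' :: 'a::ring_1^'n^'m))"
  by (simp_all add: matrix_matrix_mult_def vec_eq_iff sum_negf)

lemma minus_matrix_vector_mult: "(- A) *v x = - (A *v (x :: 'a::ring_1^'n))"
  by (simp add: matrix_vector_mult_def vec_eq_iff sum_negf)

lemma mat_mult_eq_scale: "mat c ** A = matrix_scale c A" "B ** mat c = matrix_scale c B"
  by (simp_all add: mat_eq_scale[of c] matrix_scale_mult_left matrix_scale_mult_right)

lemmas matrix_algebra =
  matrix_add_ldistrib matrix_add_mult_left matrix_diff_mult_left matrix_diff_mult_right
  matrix_minus_mult_left matrix_minus_mult_right
  matrix_scale_mult_left matrix_scale_mult_right

definition clinear_map :: "(complex^'n \<Rightarrow> complex^'b^'a) \<Rightarrow> bool"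
  where "clinear_map D \<longleftrightarrow> (\<forall>u v. D (u + v) = D u + D v) \<and> (\<forall>c u. D (c *s u) = matrix_scale c (D u))"

definition clinear_functional :: "(complex^'n \<Rightarrow> complex) \<Rightarrow> bool"
  where "clinear_functional s \<longleftrightarrow> (\<forall>u v. s (u + v) = s u + s v) \<and> (\<forall>c u. s (c *s u) = c * s u)"

lemma clinear_map_diff_scale:
  assumes "clinear_map D"
  shows "D (u - c *s a) = D u - matrix_scale c (D a)"
proof -
  have "D (u - c *s a + c *s a) = D (u - c *s a) + matrix_scale c (D a)"
    using assms unfolding clinear_map_def by metis
  then show ?thesis by simp
qed

lemma clinear_functional_coordinates:
  assumes "clinear_functional s"
  shows "s u = (\<Sum>k\<in>UNIV. s (axis k 1) * u $ k)"
proof -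
  have s0: "s 0 = 0"
    using assms unfolding clinear_functional_def by (metis add_cancel_right_right)
  have "s (\<Sum>k\<in>B. u $ k *s axis k 1) = (\<Sum>k\<in>B. s (axis k 1) * u $ k)" if "finite B" for B
    using that by induction (use assms s0 in \<open>simp_all add: clinear_functional_def mult.commute\<close>)
  from this[of UNIV] show ?thesis
    by (simp add: basis_expansion)
qed

text \<open>Polarizing the square of \<open>D\<close> shows that the anticommutator of
  \<open>D u\<close> with \<open>A\<close> is scalar. Half that scalar is the component
  \<open>s u\<close> along \<open>A\<close>; removing it leaves a part that anticommutes with
  \<open>A\<close>.\<close>

lemma split_off_involution:
  fixes D :: "complex^'n \<Rightarrow> complex^'a^'a"
  assumes D: "clinear_map D" and sq: "\<And>u. D u ** D u = mat (q u)" and w: "q w \<noteq> 0"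
  obtains A a s D'
  where "A ** A = mat 1" "A = D a" "clinear_functional s" "clinear_map D'"
    "\<And>u. D u = matrix_scale (s u) A + D' u" "\<And>u. D' u = D (u - s u *s a)"
    "\<And>u. D' u ** A = - (A ** D' u)" "\<And>u. D' u ** D' u = mat (q u - (s u)\<^sup>2)"
proof -
  have add: "D (u + v) = D u + D v" and scale: "D (c *s u) = matrix_scale c (D u)" for u v c
    using D by (auto simp: clinear_map_def)
  \<comment> \<open>A complex square root rescales \<open>w\<close> so that \<open>A\<close> squares
    to the identity.\<close>
  define c where "c = 1 / csqrt (q w)"
  define a where "a = c *s w"
  define A where "A = D a"
  have "csqrt (q w) * csqrt (q w) = q w"
    by (metis power2_csqrt power2_eq_square)
  then have "c * (c * q w) = 1"
    using w by (simp add: c_def field_simps)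
  then have AA: "A ** A = mat 1"
    by (simp add: A_def a_def scale matrix_algebra sq matrix_scale_mat)
  have anti: "D u ** A + A ** D u = mat (q (u + a) - q u - 1)" for u
  proof -
    have "mat (q (u + a)) = D u ** D u + (D u ** A + A ** D u) + A ** A"
      unfolding sq[symmetric] add A_def[symmetric] by (simp add: matrix_algebra)
    then show ?thesis
      by (simp add: sq AA mat_diff mat_add algebra_simps)
  qed
  \<comment> \<open>The anticommutator is a scalar matrix, so any diagonal entry gives its value;
    \<open>undefined\<close> is merely some index.\<close>
  define s where "s = (\<lambda>u. (D u ** A + A ** D u) $ undefined $ undefined / 2)"
  have anti2: "D u ** A + A ** D u = mat (2 * s u)" for u
  proof -
    have "2 * s u = q (u + a) - q u - 1"
      unfolding s_def anti by (simp add: mat_def)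
    then show ?thesis by (simp add: anti)
  qed
  have s: "clinear_functional s"
    unfolding clinear_functional_def s_def add scale
    by (simp add: matrix_algebra matrix_scale_nth algebra_simps add_divide_distrib)
  define D' where "D' = (\<lambda>u. D u - matrix_scale (s u) A)"
  have D'a: "D' u ** A = - (A ** D' u)" for u
  proof -
    have "D' u ** A + A ** D' u = mat (2 * s u) - matrix_scale (s u) (mat 1) - matrix_scale (s u) (mat 1)"
      by (simp add: D'_def matrix_algebra AA flip: anti2)
    also have "\<dots> = 0"
      by (simp add: matrix_scale_def mat_def vec_eq_iff)
    finally show ?thesis by (simp add: eq_neg_iff_add_eq_0)
  qed
  have D'sq: "D' u ** D' u = mat (q u - (s u)\<^sup>2)" for u
  proof -
    have "D' u ** D' u = D u ** D u - matrix_scale (s u) (D u ** A + A ** D u) + matrix_scale (s u * s u) (A ** A)"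
      by (simp add: D'_def matrix_algebra cmat.scale_right_distrib cmat.scale_right_diff_distrib)
    also have "\<dots> = mat (q u - (s u)\<^sup>2)"
      by (simp add: anti2 AA sq matrix_scale_def power2_eq_square mat_def vec_eq_iff)
    finally show ?thesis .
  qed
  show thesis
  proof (rule that[OF AA A_def s _ _ _ D'a D'sq])
    show "clinear_map D'"
      using s unfolding clinear_map_def clinear_functional_def D'_def
      by (simp add: add scale cmat.scale_left_distrib cmat.scale_right_diff_distrib)
    show "D u = matrix_scale (s u) A + D' u" for u
      by (simp add: D'_def)
    show "D' u = D (u - s u *s a)" for u
      by (simp add: clinear_map_diff_scale[OF D] D'_def A_def)
  qed
qed

text \<open>Polarizing at \<open>x\<close> makes \<open>M u + N u\<close> scalar, so
  \<open>M\<close> minus its scalar part \<open>t\<close> has scalar square. As \<rho> is not a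
  product of linear functionals, this square is nonzero somewhere, and remains so after one
  involution is split off. The range facts serve to show later that a normal form is attained in
  full.\<close>

lemma clifford_decomposition:
  fixes M N :: "complex^'n \<Rightarrow> complex^'a^'a"
  assumes M: "clinear_map M" and N: "clinear_map N"
    and MN: "\<And>u. M u ** N u = mat (\<rho> u)"
    and x: "M x = mat 1" "\<rho> x = 1"
    and np: "\<And>a b. \<not> (\<forall>u. \<rho> u = (\<Sum>k\<in>UNIV. a k * u $ k) * (\<Sum>k\<in>UNIV. b k * u $ k))"
  obtains t s1 s2 D A1 A2
  where "clinear_functional t" "clinear_functional s1" "clinear_functional s2" "clinear_map D"
    "\<And>u. M u = mat (t u) + matrix_scale (s1 u) A1 + matrix_scale (s2 u) A2 + D u"
    "A1 ** A1 = mat 1" "A2 ** A2 = mat 1" "A2 ** A1 = - (A1 ** A2)"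
    "\<And>u. D u ** A1 = - (A1 ** D u)" "\<And>u. D u ** A2 = - (A2 ** D u)"
    "\<And>u. D u ** D u = mat ((t u)\<^sup>2 - (s1 u)\<^sup>2 - (s2 u)\<^sup>2 - \<rho> u)"
    "A1 \<in> range M" "A2 \<in> range M" "\<And>u. D u \<in> range M"
proof -
  have add: "M (u + v) = M u + M v" and scale: "M (c *s u) = matrix_scale c (M u)" for u v c
    using M by (auto simp: clinear_map_def)
  have addN: "N (u + v) = N u + N v" and scaleN: "N (c *s u) = matrix_scale c (N u)" for u v c
    using N by (auto simp: clinear_map_def)
  have Nx: "N x = mat 1"
    using MN[of x] by (simp add: x)
  have tr: "M u + N u = mat (\<rho> (u + x) - \<rho> u - 1)" for u
  proof -
    have "mat (\<rho> (u + x)) = M u ** N u + (M u + N u) + mat 1"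
      unfolding MN[symmetric] add addN x Nx by (simp add: matrix_algebra)
    then show ?thesis
      by (simp add: MN mat_diff mat_add algebra_simps)
  qed
  define t where "t = (\<lambda>u. (M u + N u) $ undefined $ undefined / 2)"
  have tr2: "M u + N u = mat (2 * t u)" for u
  proof -
    have "2 * t u = \<rho> (u + x) - \<rho> u - 1"
      unfolding t_def tr by (simp add: mat_def)
    then show ?thesis by (simp add: tr)
  qed
  have t: "clinear_functional t"
    unfolding clinear_functional_def t_def add scale addN scaleN
    by (simp add: matrix_scale_nth algebra_simps add_divide_distrib)
  define D0 where "D0 = (\<lambda>u. M u - mat (t u))"
  have D0M: "D0 u = M (u - t u *s x)" for u
    by (simp add: clinear_map_diff_scale[OF M] D0_def x matrix_scale_mat)
  have D0: "clinear_map D0"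
    using t unfolding clinear_map_def clinear_functional_def D0_def
    by (simp add: add scale mat_add cmat.scale_right_diff_distrib matrix_scale_mat)
  have D0sq: "D0 u ** D0 u = mat ((t u)\<^sup>2 - \<rho> u)" for u
  proof -
    \<comment> \<open>Eliminating \<open>N u\<close> turns the hypothesis into a quadratic equation
      for \<open>M u\<close>; passing to \<open>D0\<close> completes the square.\<close>
    have Nu: "N u = mat (2 * t u) - M u"
      using tr2[of u] by (simp add: algebra_simps)
    have "mat (\<rho> u) = matrix_scale (2 * t u) (M u) - M u ** M u"
      unfolding MN[symmetric] Nu by (simp add: matrix_algebra mat_mult_eq_scale)
    then have MM: "M u ** M u = matrix_scale (2 * t u) (M u) - mat (\<rho> u)"
      by (simp add: algebra_simps)
    have "D0 u ** D0 u = M u ** M u - (matrix_scale (t u) (M u) + matrix_scale (t u) (M u)) + mat (t u * t u)"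
      by (simp add: D0_def matrix_algebra mat_mult_eq_scale matrix_scale_mat cmat.scale_right_diff_distrib)
    also have "\<dots> = M u ** M u - matrix_scale (2 * t u) (M u) + mat ((t u)\<^sup>2)"
      unfolding mult_2 cmat.scale_left_distrib power2_eq_square ..
    also have "\<dots> = mat ((t u)\<^sup>2 - \<rho> u)"
      by (simp add: MM mat_diff)
    finally show ?thesis .
  qed
  have prod: "\<not> (\<forall>u. \<rho> u = f u * g u)" if "clinear_functional f" "clinear_functional g" for f g
    using np[of "\<lambda>k. f (axis k 1)" "\<lambda>k. g (axis k 1)"]
    by (simp flip: clinear_functional_coordinates[OF that(1)] clinear_functional_coordinates[OF that(2)])
  \<comment> \<open>If \<open>D0\<close> had square 0 everywhere, \<rho> would be the product of
    \<open>t\<close> with itself.\<close>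
  obtain w where "\<rho> w \<noteq> t w * t w"
    using prod[OF t t] by blast
  then have "(t w)\<^sup>2 - \<rho> w \<noteq> 0"
    by (simp add: power2_eq_square)
  from split_off_involution[OF D0 D0sq this]
  obtain A1 a1 s1 D1 where A1: "A1 ** A1 = mat 1" "A1 = D0 a1" "clinear_functional s1" "clinear_map D1"
    "\<And>u. D0 u = matrix_scale (s1 u) A1 + D1 u" "\<And>u. D1 u = D0 (u - s1 u *s a1)"
    "\<And>u. D1 u ** A1 = - (A1 ** D1 u)" "\<And>u. D1 u ** D1 u = mat ((t u)\<^sup>2 - \<rho> u - (s1 u)\<^sup>2)"
    by blast
  \<comment> \<open>If \<open>D1\<close> had square 0 everywhere, \<rho> would be the difference of
    squares \<open>(t + s1) * (t - s1)\<close>.\<close>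
  have "clinear_functional (\<lambda>u. t u + s1 u)" "clinear_functional (\<lambda>u. t u - s1 u)"
    using t A1(3) by (auto simp: clinear_functional_def algebra_simps)
  from prod[OF this] obtain w where "\<rho> w \<noteq> (t w + s1 w) * (t w - s1 w)"
    by blast
  then have "(t w)\<^sup>2 - \<rho> w - (s1 w)\<^sup>2 \<noteq> 0"
    by (auto simp: power2_eq_square algebra_simps)
  from split_off_involution[OF A1(4) A1(8) this]
  obtain A2 a2 s2 D2 where A2: "A2 ** A2 = mat 1" "A2 = D1 a2" "clinear_functional s2" "clinear_map D2"
    "\<And>u. D1 u = matrix_scale (s2 u) A2 + D2 u" "\<And>u. D2 u = D1 (u - s2 u *s a2)"
    "\<And>u. D2 u ** A2 = - (A2 ** D2 u)" "\<And>u. D2 u ** D2 u = mat ((t u)\<^sup>2 - \<rho> u - (s1 u)\<^sup>2 - (s2 u)\<^sup>2)"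
    by blast
  show thesis
  proof (rule that[OF t A1(3) A2(3) A2(4) _ A1(1) A2(1) _ _ A2(7)])
    show "M u = mat (t u) + matrix_scale (s1 u) A1 + matrix_scale (s2 u) A2 + D2 u" for u
      using A1(5)[of u] A2(5)[of u] by (simp add: D0_def algebra_simps)
    show "A2 ** A1 = - (A1 ** A2)" "D2 u ** A1 = - (A1 ** D2 u)" for u
      by (simp_all add: A2(2,6) A1(7))
    show "D2 u ** D2 u = mat ((t u)\<^sup>2 - (s1 u)\<^sup>2 - (s2 u)\<^sup>2 - \<rho> u)" for u
      unfolding A2(8) by (simp add: algebra_simps)
    show "A1 \<in> range M" "A2 \<in> range M" "D2 u \<in> range M" for u
      by (simp_all add: A1(2,6) A2(2,6) D0M)
  qed
qed

section \<open>Anticommuting involutions in dimension four\<close>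

definition pauli_z :: "complex^4^4"
  where "pauli_z = vector [vector [1, 0, 0, 0], vector [0, -1, 0, 0], vector [0, 0, 1, 0], vector [0, 0, 0, -1]]"

definition pauli_x :: "complex^4^4"
  where "pauli_x = vector [vector [0, 1, 0, 0], vector [1, 0, 0, 0], vector [0, 0, 0, 1], vector [0, 0, 1, 0]]"

text \<open>The Kronecker product of \<open>T\<close> with rows \<open>(a, b)\<close>,
  \<open>(c, d)\<close> and \<epsilon> with rows \<open>(0, 1)\<close>,
  \<open>(-1, 0)\<close>.\<close>

definition twist :: "complex \<Rightarrow> complex \<Rightarrow> complex \<Rightarrow> complex \<Rightarrow> complex^4^4"
  where "twist a b c d = vector [vector [0, a, 0, b], vector [-a, 0, -b, 0], vector [0, c, 0, d], vector [-c, 0, -d, 0]]"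

text \<open>
  As \<open>A2\<close> exchanges the eigenspaces of \<open>A1\<close>, the columns of \<open>P\<close> can be \<open>v1, A2 v1, v2, A2 v2\<close> with
  \<open>v1, v2\<close> a basis of the eigenspace of \<open>A1\<close> for the eigenvalue 1.
\<close>

lemma anticommuting_involutions_normal_form:
  fixes A1 A2 :: "complex^4^4"
  assumes A: "A1 ** A1 = mat 1" "A2 ** A2 = mat 1" "A2 ** A1 = - (A1 ** A2)"
  obtains P P' where "P ** P' = mat 1" "P' ** P = mat 1" "P' ** A1 ** P = pauli_z" "P' ** A2 ** P = pauli_x"
proof -
  have v11: "A1 *v (A1 *v v) = v" and v22: "A2 *v (A2 *v v) = v"
    and v21: "A1 *v (A2 *v v) = - (A2 *v (A1 *v v))" for v
    using A by (simp_all add: matrix_vector_mul_assoc minus_matrix_vector_mult)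
  note lin = matrix_vector_right_distrib matrix_vector_mult_diff_distrib vec.scale v11 v22 v21
  \<comment> \<open>\<open>A1\<close> is not minus the identity: anticommutation would then force
    \<open>A2 = 0\<close>.\<close>
  have "\<exists>w. w + A1 *v w \<noteq> 0"
  proof (rule ccontr)
    assume "\<nexists>w. w + A1 *v w \<noteq> 0"
    then have m: "A1 *v w = - w" for w
      by (metis add.commute eq_neg_iff_add_eq_0)
    have "A2 *v w = 0" for w
      using v21[of w] by (simp add: m vec.neg vec_eq_iff)
    then have "w = 0" for w :: "complex^4"
      by (metis v22)
    from this[of "axis 1 1"] show False by simp
  qed
  then obtain w where "w + A1 *v w \<noteq> 0" by blast
  define v1 where "v1 = w + A1 *v w"
  have v1: "A1 *v v1 = v1" "v1 \<noteq> 0"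
    using \<open>w + A1 *v w \<noteq> 0\<close> by (simp_all add: v1_def lin add.commute)
  \<comment> \<open>The eigenspace for 1 is not a line: \<open>2 w\<close> is the sum of
    \<open>w + A1 w\<close>, which lies in it, and \<open>w - A1 w\<close>, which \<open>A2\<close>
    maps into it, so a line would bound the whole dimension by 2.\<close>
  have "\<exists>v. A1 *v v = v \<and> (\<forall>c. v \<noteq> c *s v1)"
  proof (rule ccontr)
    assume n: "\<nexists>v. A1 *v v = v \<and> (\<forall>c. v \<noteq> c *s v1)"
    have "w \<in> vec.span {v1, A2 *v v1}" for w
    proof -
      have "A1 *v (w + A1 *v w) = w + A1 *v w" "A1 *v (A2 *v (w - A1 *v w)) = A2 *v (w - A1 *v w)"
        by (simp_all add: lin add.commute)
      then obtain c d where c: "w + A1 *v w = c *s v1" and d: "A2 *v (w - A1 *v w) = d *s v1"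
        using n by blast
      have "w - A1 *v w = d *s (A2 *v v1)"
        using arg_cong[OF d, of "\<lambda>v. A2 *v v"] by (simp add: v22 vec.scale)
      with c have "c *s v1 + d *s (A2 *v v1) = 2 *s w"
        by (metis (no_types, lifting) add_diff_eq diff_add_eq add_diff_cancel_right' one_add_one vec.scale_left_distrib vec.scale_one add.assoc)
      then have "w = (1/2) *s (c *s v1 + d *s (A2 *v v1))"
        by (simp add: vector_smult_assoc)
      also have "\<dots> \<in> vec.span {v1, A2 *v v1}"
        by (intro vec.span_scale vec.span_add vec.span_base) auto
      finally show ?thesis .
    qed
    then have "vec.dim (UNIV :: (complex^4) set) \<le> card {v1, A2 *v v1}"
      by (intro vec.dim_le_card) auto
    also have "\<dots> \<le> 2"
      by (simp add: card_insert_if)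
    finally show False
      by (simp add: card_cart_basis)
  qed
  then obtain v2 where v2: "A1 *v v2 = v2" "\<And>c. v2 \<noteq> c *s v1" by blast
  define P :: "complex^4^4" where "P = (\<chi> i j. if j = 1 then v1 $ i else if j = 2 then (A2 *v v1) $ i
     else if j = 3 then v2 $ i else (A2 *v v2) $ i)"
  have P: "P *v x = x $ 1 *s v1 + x $ 2 *s (A2 *v v1) + x $ 3 *s v2 + x $ 4 *s (A2 *v v2)" for x
    by (simp add: P_def matrix_vector_mult_def vec_eq_iff sum_4 mult.commute)
  have indep: "\<alpha> = 0 \<and> \<beta> = 0" if "\<alpha> *s v1 + \<beta> *s v2 = 0" for \<alpha> \<beta>
  proof -
    have "\<beta> = 0"
    proof (rule ccontr)
      assume "\<beta> \<noteq> 0"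
      then have "v2 = (- \<alpha> / \<beta>) *s v1"
        using that by (auto simp: vec_eq_iff field_simps eq_neg_iff_add_eq_0)
      with v2(2) show False by blast
    qed
    with that v1(2) show ?thesis by simp
  qed
  have "x = 0" if "P *v x = 0" for x
  proof -
    let ?y = "x $ 1 *s v1 + x $ 3 *s v2" and ?z = "x $ 2 *s v1 + x $ 4 *s v2"
    have 1: "?y + A2 *v ?z = 0"
      using that by (simp add: P lin algebra_simps)
    \<comment> \<open>\<open>A1\<close> changes the sign of the part in the eigenspace for -1, so
      the two parts vanish separately.\<close>
    have "A1 *v (?y + A2 *v ?z) = ?y - A2 *v ?z"
      by (simp add: lin v1 v2 vec.neg algebra_simps)
    then have 2: "?y - A2 *v ?z = 0"
      by (simp add: 1)
    have "?y = 0" "A2 *v ?z = 0"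
      using 1 2 by (auto simp: vec_eq_iff)
    then have "?y = 0" "?z = 0"
      using v22[of ?z] by auto
    then show ?thesis
      using indep[of "x $ 1" "x $ 3"] indep[of "x $ 2" "x $ 4"] by (simp add: vec_eq_iff forall_4)
  qed
  then obtain P' where P': "P' ** P = mat 1"
    using matrix_left_invertible_ker by blast
  then have PP': "P ** P' = mat 1"
    by (simp add: matrix_left_right_inverse)
  have z: "pauli_z *v x = vector [x $ 1, - x $ 2, x $ 3, - x $ 4]"
    and x: "pauli_x *v x = vector [x $ 2, x $ 1, x $ 4, x $ 3]" for x
    by (simp_all add: pauli_z_def pauli_x_def vec_eq_iff forall_4 matrix_vector_mult_def sum_4)
  have "A1 ** P = P ** pauli_z"
    by (rule matrix_eq[THEN iffD2]) (simp add: P z lin v1 v2 vec.neg flip: matrix_vector_mul_assoc)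
  moreover have "A2 ** P = P ** pauli_x"
    by (rule matrix_eq[THEN iffD2]) (simp add: P x lin v1 v2 vec.neg flip: matrix_vector_mul_assoc)
  ultimately show thesis
    using that[OF PP' P'] P' by (simp add: matrix_mul_assoc flip: matrix_mul_assoc[of P'])
qed

text \<open>Anticommuting with \<open>pauli_z\<close> kills the entries whose row and column have
  the same parity, where its eigenvalues agree; anticommuting with \<open>pauli_x\<close> then makes
  every 2 by 2 block skew.\<close>

lemma anticommuting_eq_twist:
  assumes z: "B ** pauli_z = - (pauli_z ** B)" and x: "B ** pauli_x = - (pauli_x ** B)"
  shows "B = twist (B $ 1 $ 2) (B $ 1 $ 4) (B $ 3 $ 2) (B $ 3 $ 4)"
proof -
  have "(B ** pauli_z) $ i $ j = - (pauli_z ** B) $ i $ j" "(B ** pauli_x) $ i $ j = - (pauli_x ** B) $ i $ j" for i j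
    using z x by simp_all
  note e = this[unfolded matrix_matrix_mult_def sum_4 pauli_z_def pauli_x_def, simplified]
  have "B $ 1 $ 1 = 0" "B $ 1 $ 3 = 0" "B $ 2 $ 2 = 0" "B $ 2 $ 4 = 0"
    "B $ 3 $ 1 = 0" "B $ 3 $ 3 = 0" "B $ 4 $ 2 = 0" "B $ 4 $ 4 = 0"
    using e(1)[of 1 1] e(1)[of 1 3] e(1)[of 2 2] e(1)[of 2 4]
      e(1)[of 3 1] e(1)[of 3 3] e(1)[of 4 2] e(1)[of 4 4] by simp_all
  moreover have "B $ 2 $ 1 = - B $ 1 $ 2" "B $ 2 $ 3 = - B $ 1 $ 4" "B $ 4 $ 1 = - B $ 3 $ 2" "B $ 4 $ 3 = - B $ 3 $ 4"
    using e(2)[of 2 2] e(2)[of 2 4] e(2)[of 4 2] e(2)[of 4 4] by simp_all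
  ultimately show ?thesis
    by (simp add: vec_eq_iff forall_4 twist_def)
qed

text \<open>The square of \<open>T \<otimes> \<epsilon>\<close> is
  \<open>- T\<^sup>2 \<otimes> I\<close>, so the claims are the entries of
  \<open>T\<^sup>2 = - q I\<close>.\<close>

lemma twist_square:
  assumes "twist a b c d ** twist a b c d = mat q"
  shows "b * (a + d) = 0" "c * (a + d) = 0" "a * a = d * d" "q = - (a * a + b * c)"
proof -
  have "(twist a b c d ** twist a b c d) $ i $ j = mat q $ i $ j" for i j
    using assms by simp
  from this[of 1 1] this[of 1 3] this[of 3 1] this[of 3 3]
  have "- (a * a) - b * c = q" "- (a * b) - b * d = 0" "- (c * a) - d * c = 0" "- (c * b) - d * d = q"
    by (simp_all add: matrix_matrix_mult_def sum_4 twist_def mat_def)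
  note eqs = this
  have "b * (a + d) = - (- (a * b) - b * d)" "c * (a + d) = - (- (c * a) - d * c)"
    "a * a - d * d = (- (c * b) - d * d) - (- (a * a) - b * c)"
    by (simp_all add: algebra_simps)
  then show "b * (a + d) = 0" "c * (a + d) = 0" "a * a = d * d"
    unfolding eqs by simp_all
  show "q = - (a * a + b * c)"
    using eqs(1) by (simp add: algebra_simps)
qed

section \<open>Pencils of matrices and bases\<close>

text \<open>The value of \<open>linear_form_matrix f\<close> at the point \<open>u\<close>, as a
  complex matrix that can be inverted and conjugated.\<close>

definition pencil :: "('k::finite \<Rightarrow> complex^'b^'a) \<Rightarrow> complex^'k \<Rightarrow> complex^'b^'a"
  where "pencil f u = (\<Sum>k\<in>UNIV. matrix_scale (u $ k) (f k))"

lemma clinear_map_pencil: "clinear_map (pencil f)"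
  by (simp add: clinear_map_def pencil_def cmat.scale_left_distrib sum.distrib cmat.scale_sum_right)

lemma pencil_axis: "pencil f (axis k 1) = f k"
proof -
  have "pencil f (axis k 1) = (\<Sum>i\<in>UNIV. if i = k then f i else 0)"
    unfolding pencil_def by (rule sum.cong) (auto simp: axis_def)
  then show ?thesis by simp
qed

lemma pencil_0 [simp]: "pencil f 0 = 0"
  by (simp add: pencil_def)

lemma matrix_mul_sum_left: "(\<Sum>k\<in>B. f k) ** A = (\<Sum>k\<in>B. f k ** (A :: complex^'n^'m))"
  by (induction B rule: infinite_finite_induct) (simp_all add: matrix_add_mult_left)

lemma matrix_mul_sum_right: "A ** (\<Sum>k\<in>B. f k) = (\<Sum>k\<in>B. (A :: complex^'n^'m) ** f k)"
  by (induction B rule: infinite_finite_induct) (simp_all add: matrix_add_ldistrib)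

lemma pencil_conj: "pencil (\<lambda>k. P ** f k ** Q) u = P ** pencil f u ** Q"
  by (simp add: pencil_def matrix_mul_sum_left matrix_mul_sum_right matrix_scale_mult_left matrix_scale_mult_right)

lemma eval_linear_form_matrix: "eval (($) u) (linear_form_matrix e $ i $ j) = pencil e u $ i $ j"
  by (simp add: linear_form_matrix_nth eval_linear_form pencil_def matrix_scale_def mult.commute)

lemma eval_det_linear_form_matrix: "eval (($) u) (det (linear_form_matrix e)) = det (pencil e u)"
  unfolding id_hom.insertion_det eval_linear_form_matrix by simp

lemma sum_range_eq_pencil:
  assumes "inj f"
  shows "(\<Sum>v\<in>range f. matrix_scale (c v) v) = pencil f (\<chi> k. c (f k))"
  using assms by (simp add: sum.reindex pencil_def)

text \<open>Coefficients are indexed by \<open>'k\<close> on one side and by the members of the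
  family on the other. The two agree once \<open>f\<close> is injective, which a trivial kernel of
  \<open>pencil f\<close> forces.\<close>

lemma is_basis_iff_pencil:
  fixes f :: "'k::finite \<Rightarrow> complex^'b^'a"
  shows "is_basis f E \<longleftrightarrow> (\<forall>u. pencil f u = 0 \<longrightarrow> u = 0) \<and> range (pencil f) = E"
proof -
  have inj: "inj f" if z: "\<And>u. pencil f u = 0 \<Longrightarrow> u = 0"
  proof (rule injI, rule ccontr)
    fix i j assume ij: "f i = f j" "i \<noteq> j"
    have "pencil f (axis i 1 - axis j 1) = 0"
      using clinear_map_diff_scale[OF clinear_map_pencil, of f "axis i 1" 1 "axis j 1"] ij by (simp add: pencil_axis)
    then have "axis i 1 - axis j (1 :: complex) = 0" by (rule z)
    then have "(axis i 1 - axis j (1 :: complex)) $ i = 0" by simp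
    then show False using ij(2) by (simp add: axis_def)
  qed
  have ind: "cmat.independent (range f) \<longleftrightarrow> (\<forall>u. pencil f u = 0 \<longrightarrow> u = 0)" if i: "inj f"
  proof -
    have "cmat.dependent (range f) \<longleftrightarrow> (\<exists>c. (\<exists>k. c (f k) \<noteq> 0) \<and> pencil f (\<chi> k. c (f k)) = 0)"
      by (simp add: cmat.dependent_finite sum_range_eq_pencil[OF i])
    also have "\<dots> \<longleftrightarrow> (\<exists>u. u \<noteq> 0 \<and> pencil f u = 0)"
    proof safe
      fix u assume u: "u \<noteq> 0" "pencil f u = 0"
      have "(\<chi> k. u $ inv f (f k)) = u"
        by (simp add: i)
      then show "\<exists>c. (\<exists>k. c (f k) \<noteq> 0) \<and> pencil f (\<chi> k. c (f k)) = 0"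
        using u i by (intro exI[of _ "\<lambda>v. u $ inv f v"]) (auto simp: vec_eq_iff)
    next
      fix c k assume c: "pencil f (\<chi> k. c (f k)) = 0" "c (f k) \<noteq> 0"
      then show "\<exists>u. u \<noteq> 0 \<and> pencil f u = 0"
        by (intro exI[of _ "\<chi> k. c (f k)"]) (auto simp: vec_eq_iff)
    qed
    finally show ?thesis by blast
  qed
  have span: "cmat.span (range f) = range (pencil f)" if i: "inj f"
  proof -
    have "cmat.span (range f) = range (\<lambda>c. pencil f (\<chi> k. c (f k)))"
      by (simp add: cmat.span_finite sum_range_eq_pencil[OF i])
    also have "\<dots> = range (pencil f)"
    proof safe
      fix u
      have "pencil f u = pencil f (\<chi> k. u $ inv f (f k))"
        by (simp add: i)
      then show "pencil f u \<in> range (\<lambda>c. pencil f (\<chi> k. c (f k)))"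
        by (rule range_eqI[of _ _ "\<lambda>v. u $ inv f v"])
    qed simp
    finally show ?thesis .
  qed
  show ?thesis
    unfolding is_basis_def using inj ind span by metis
qed

lemma card_basis_unique:
  fixes f :: "'k::finite \<Rightarrow> complex^'b^'a" and g :: "'l::finite \<Rightarrow> complex^'b^'a"
  assumes "is_basis f E" "is_basis g E"
  shows "CARD('k) = CARD('l)"
proof -
  have "cmat.dim E = card (range f)" "cmat.dim E = card (range g)"
    using assms unfolding is_basis_def by (metis cmat.dim_span_eq_card_independent)+
  moreover have "card (range f) = CARD('k)" "card (range g) = CARD('l)"
    using assms unfolding is_basis_def by (simp_all add: card_image)
  ultimately show ?thesis by simp
qed

section \<open>Normal forms\<close>

definition double_block :: "complex^4 \<Rightarrow> complex^4^4"
  where "double_block y = vector [vector [y $ 1, y $ 2, 0, 0], vector [y $ 3, y $ 4, 0, 0],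
    vector [0, 0, y $ 1, y $ 2], vector [0, 0, y $ 3, y $ 4]]"

text \<open>This is \<open>\<epsilon> \<otimes> I\<close>; its inverse is its negative.\<close>

definition symplectic_unit :: "complex^4^4"
  where "symplectic_unit = vector [vector [0, 0, 1, 0], vector [0, 0, 0, 1],
    vector [-1, 0, 0, 0], vector [0, -1, 0, 0]]"

lemma invertible_symplectic_unit: "invertible symplectic_unit"
proof -
  have "symplectic_unit ** (- symplectic_unit) = mat 1"
    by (simp add: vec_eq_iff forall_4 matrix_matrix_mult_def sum_4 symplectic_unit_def mat_def)
  then show ?thesis
    using invertible_right_inverse by blast
qed

lemma normal_form_entries:
  "mat t + matrix_scale s pauli_z + matrix_scale r pauli_x + twist a b c d
    = vector [vector [t + s, r + a, 0, b], vector [r - a, t - s, - b, 0],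
              vector [0, c, t + s, r + d], vector [- c, 0, r - d, t - s]]"
  by (simp add: vec_eq_iff forall_4 pauli_z_def pauli_x_def twist_def mat_def matrix_scale_nth)

text \<open>The first three summands become \<open>\<epsilon> \<otimes> \<sigma>\<close> with
  \<sigma> symmetric, the last one \<open>T \<epsilon> \<otimes> \<epsilon>\<close>, where
  \<open>T \<epsilon>\<close> is symmetric because \<open>T\<close> has trace 0. A Kronecker product
  of a symmetric and a skew matrix is skew.\<close>

lemma skew_symmetric_normal_form:
  "skew_symmetric ((mat t + matrix_scale s pauli_z + matrix_scale r pauli_x + twist a b c (- a)) ** symplectic_unit)"
  unfolding normal_form_entries skew_symmetric_def transpose_def
  by (simp add: vec_eq_iff forall_4 matrix_matrix_mult_def sum_4 symplectic_unit_def)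

text \<open>For scalar \<open>T\<close> every summand has the form \<open>I \<otimes> X\<close>, and
  the four parameters are linear coordinates on all 2 by 2 matrices \<open>X\<close>.\<close>

lemma double_block_normal_form:
  "mat t + matrix_scale s pauli_z + matrix_scale r pauli_x + twist a 0 0 a
    = double_block (vector [t + s, r + a, r - a, t - s])"
  unfolding normal_form_entries by (simp add: double_block_def)

lemma double_block_inj: "double_block y = double_block z \<Longrightarrow> y = z"
  by (simp add: double_block_def vec_eq_iff forall_4)

lemma matrix_conj_mult:
  fixes P P' :: "complex^'m^'m"
  assumes "P ** P' = mat 1"
  shows "(P' ** X ** P) ** (P' ** Y ** P) = P' ** (X ** Y) ** P"
proof -
  have "(P' ** X ** P) ** (P' ** Y ** P) = P' ** X ** (P ** P') ** Y ** P"
    by (simp only: matrix_mul_assoc)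
  then show ?thesis
    by (simp add: assms matrix_mul_assoc)
qed

text \<open>In a basis adapted to the two involutions the remaining part is
  \<open>T \<otimes> \<epsilon>\<close> with \<open>T\<^sup>2\<close> scalar, so each
  \<open>T\<close> has trace 0 or is scalar. Linearity in \<open>u\<close> makes one alternative
  hold for all \<open>u\<close>.\<close>

lemma clifford_normal_form:
  fixes M N :: "complex^'n \<Rightarrow> complex^4^4"
  assumes M: "clinear_map M" and N: "clinear_map N"
    and MN: "\<And>u. M u ** N u = mat (\<rho> u)"
    and x: "M x = mat 1" "\<rho> x = 1"
    and np: "\<And>a b. \<not> (\<forall>u. \<rho> u = (\<Sum>k\<in>UNIV. a k * u $ k) * (\<Sum>k\<in>UNIV. b k * u $ k))"
  obtains (skew) P P' where "P ** P' = mat 1" "P' ** P = mat 1"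
      "\<And>u. skew_symmetric (P' ** M u ** P ** symplectic_unit)"
  | (double) P P' y where "P ** P' = mat 1" "P' ** P = mat 1"
      "\<And>u. P' ** M u ** P = double_block (y u)" "\<And>u v. y (u + v) = y u + y v" "surj y"
      "\<And>u. \<rho> u = y u $ 1 * y u $ 4 - y u $ 2 * y u $ 3"
proof -
  obtain t s1 s2 D A1 A2
    where t: "clinear_functional t" "clinear_functional s1" "clinear_functional s2" "clinear_map D"
    and Mu: "\<And>u. M u = mat (t u) + matrix_scale (s1 u) A1 + matrix_scale (s2 u) A2 + D u"
    and A: "A1 ** A1 = mat 1" "A2 ** A2 = mat 1" "A2 ** A1 = - (A1 ** A2)"
    and DA: "\<And>u. D u ** A1 = - (A1 ** D u)" "\<And>u. D u ** A2 = - (A2 ** D u)"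
    and DD: "\<And>u. D u ** D u = mat ((t u)\<^sup>2 - (s1 u)\<^sup>2 - (s2 u)\<^sup>2 - \<rho> u)"
    and rng: "A1 \<in> range M" "A2 \<in> range M" "\<And>u. D u \<in> range M"
    using clifford_decomposition[OF M N MN x np] by blast
  obtain P P' where P: "P ** P' = mat 1" "P' ** P = mat 1" "P' ** A1 ** P = pauli_z" "P' ** A2 ** P = pauli_x"
    using anticommuting_involutions_normal_form[OF A] by blast
  note cm = matrix_conj_mult[OF P(1)]
  define B where "B = (\<lambda>u. P' ** D u ** P)"
  have B: "B u ** pauli_z = - (pauli_z ** B u)" "B u ** pauli_x = - (pauli_x ** B u)" for u
    by (simp_all add: B_def cm DA matrix_algebra flip: P(3,4))
  define a b c d where "a = (\<lambda>u. B u $ 1 $ 2)" and "b = (\<lambda>u. B u $ 1 $ 4)"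
    and "c = (\<lambda>u. B u $ 3 $ 2)" and "d = (\<lambda>u. B u $ 3 $ 4)"
  note abcd = a_def b_def c_def d_def
  have Bt: "B u = twist (a u) (b u) (c u) (d u)" for u
    unfolding abcd by (rule anticommuting_eq_twist[OF B])
  have PmP: "P' ** mat z ** P = mat z" for z
    by (simp add: mat_mult_eq_scale matrix_scale_mult_left P(2) matrix_scale_mat)
  have sq: "twist (a u) (b u) (c u) (d u) ** twist (a u) (b u) (c u) (d u)
      = mat ((t u)\<^sup>2 - (s1 u)\<^sup>2 - (s2 u)\<^sup>2 - \<rho> u)" for u
    by (simp add: B_def cm DD PmP flip: Bt)
  note tw = twist_square[OF sq]
  have PMP: "P' ** M u ** P = mat (t u) + matrix_scale (s1 u) pauli_z + matrix_scale (s2 u) pauli_x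
      + twist (a u) (b u) (c u) (d u)" for u
    unfolding Mu Bt[symmetric] by (simp add: matrix_algebra PmP B_def flip: P(3,4))
  show thesis
  proof (cases "\<forall>u. a u + d u = 0")
    case True
    then have "d u = - a u" for u
      by (simp add: eq_neg_iff_add_eq_0 add.commute)
    then show thesis
      by (intro skew[OF P(1,2)]) (simp add: PMP skew_symmetric_normal_form)
  next
    case False
    then obtain w where w: "a w + d w \<noteq> 0" by blast
    have addB: "B (u + v) = B u + B v" for u v
      using t(4) by (simp add: B_def clinear_map_def matrix_algebra)
    have add: "a (u + v) = a u + a v" "b (u + v) = b u + b v" "c (u + v) = c u + c v" "d (u + v) = d u + d v" for u v
      by (simp_all add: abcd addB)
    have b: "b w = 0" "c w = 0" "a w = d w"
      using tw(1,2,3)[of w] w by (auto simp: square_eq_iff)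
    \<comment> \<open>If \<open>T u\<close> has trace 0, then \<open>T (u + w)\<close> has the
      nonzero trace of \<open>T w\<close> and is scalar; hence so is the difference
      \<open>T u\<close>.\<close>
    have scalar: "b u = 0 \<and> c u = 0 \<and> d u = a u" for u
    proof (cases "a u + d u = 0")
      case True
      have "a (u + w) + d (u + w) = a w + d w"
        using True by (simp add: add algebra_simps)
      then have nz: "a (u + w) + d (u + w) \<noteq> 0"
        using w by simp
      have "a (u + w) = d (u + w)" "b (u + w) = 0" "c (u + w) = 0"
        using tw(1,2,3)[of "u + w"] nz by (auto simp: square_eq_iff)
      then show ?thesis
        by (simp add: add b)
    next
      case False
      then show ?thesis
        using tw(1,2,3)[of u] by (auto simp: square_eq_iff)
    qed
    define y :: "complex^'n \<Rightarrow> complex^4"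
      where "y = (\<lambda>u. vector [t u + s1 u, s2 u + a u, s2 u - a u, t u - s1 u])"
    have y: "P' ** M u ** P = double_block (y u)" for u
      unfolding PMP y_def using scalar[of u] by (simp add: double_block_normal_form)
    show thesis
    proof (rule double[OF P(1,2) y])
      show "y (u + v) = y u + y v" for u v
        using t add by (simp add: y_def vec_eq_iff forall_4 clinear_functional_def)
      \<comment> \<open>The square of \<open>D u\<close> gives
        \<open>t\<^sup>2 - s1\<^sup>2 - s2\<^sup>2 - \<rho> = - a\<^sup>2\<close>, so \<rho> is the
        determinant of \<open>X\<close>.\<close>
      show "\<rho> u = y u $ 1 * y u $ 4 - y u $ 2 * y u $ 3" for u
        using tw(4)[of u] scalar[of u] by (simp add: y_def power2_eq_square algebra_simps)
      show "surj y"
        unfolding surj_def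
      proof
        fix z :: "complex^4"
        \<comment> \<open>\<open>M\<close> sends \<open>x\<close>, \<open>a1\<close>,
          \<open>a2\<close>, \<open>w'\<close> to the identity, the involutions and
          \<open>D w\<close>, whose conjugates span all \<open>I \<otimes> X\<close>. The
          coefficients below are the coordinates of \<open>z\<close>, with a division by
          \<open>a w\<close> to normalize the last one.\<close>
        obtain a1 a2 w' where r: "A1 = M a1" "A2 = M a2" "D w = M w'"
          using rng by blast
        have aw: "a w \<noteq> 0" using w b by auto
        have Mlin: "M (u + v) = M u + M v" "M (k *s u) = matrix_scale k (M u)" for u v k
          using M by (auto simp: clinear_map_def)
        let ?t = "(z $ 1 + z $ 4) / 2" and ?s = "(z $ 1 - z $ 4) / 2"
          and ?r = "(z $ 2 + z $ 3) / 2" and ?a = "(z $ 2 - z $ 3) / 2"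
        define u where "u = ?t *s x + ?s *s a1 + ?r *s a2 + (?a / a w) *s w'"
        have "P' ** M u ** P = matrix_scale ?t (mat 1) + matrix_scale ?s pauli_z + matrix_scale ?r pauli_x
            + matrix_scale (?a / a w) (B w)"
          by (simp add: u_def Mlin x matrix_algebra PmP B_def P(2) flip: r P(3,4))
        also have "matrix_scale (?a / a w) (B w) = twist ?a 0 0 ?a"
          using b aw by (simp add: Bt twist_def matrix_scale_def vec_eq_iff forall_4)
        also have "matrix_scale ?t (mat 1) = mat ?t"
          by (simp add: matrix_scale_mat)
        also have "mat ?t + matrix_scale ?s pauli_z + matrix_scale ?r pauli_x + twist ?a 0 0 ?a = double_block z"
          unfolding double_block_normal_form
          by (rule arg_cong[of _ _ double_block]) (simp add: vec_eq_iff forall_4 field_simps)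
        finally have "y u = z"
          unfolding y by (rule double_block_inj)
        then show "\<exists>u. z = y u" by blast
      qed
    qed
  qed
qed

section \<open>Ranks, double blocks and skew matrices\<close>

lemma rank_eq_CARD_imp_det:
  fixes A :: "'a::field^'n^'n"
  assumes "rank A = CARD('n)"
  shows "det A \<noteq> 0"
proof -
  have "vec.span (rows A) = UNIV"
    using assms by (simp add: row_rank_def_gen vec.dim_eq_full[symmetric] vec.dimension_def card_cart_basis)
  then show ?thesis
    unfolding invertible_det_nz[symmetric] invertible_left_inverse matrix_left_invertible_span_rows_gen .
qed

lemma rank_le_CARD: "rank (A :: 'a::field^'n^'m) \<le> CARD('n)"
  unfolding row_rank_def_gen using vec.dim_subset_UNIV[of "rows A"]
  by (simp add: vec.dimension_def card_cart_basis)

lemma pencil_double_block: "pencil (\<lambda>k. double_block (axis k 1)) z = double_block z"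
  by (simp add: pencil_def vec_eq_iff forall_4 sum_4 double_block_def matrix_scale_def axis_def)

lemma linear_form_matrix_double_block:
  "linear_form_matrix (\<lambda>k. double_block (axis k 1)) = block_diag generic_2x2 generic_2x2"
  by (simp add: linear_form_matrix_def vec_eq_iff forall_4 sum_4 double_block_def axis_def
      block_diag_def generic_2x2_def)

lemma skew_symmetric_linear_form_matrix:
  assumes "\<And>k. skew_symmetric (f k)"
  shows "skew_symmetric (linear_form_matrix f)"
proof -
  have neg: "f k $ j $ i = - f k $ i $ j" for k i j
    using assms[of k] unfolding skew_symmetric_def
    by (metis (no_types) transpose_def vec_lambda_beta vector_uminus_component)
  have Const_neg: "Const (- c) = - Const c" for c
    by (simp add: Const_def single_uminus)
  have "linear_form_matrix f $ j $ i = - linear_form_matrix f $ i $ j" for i j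
    by (simp add: linear_form_matrix_def neg[of _ j i] Const_neg sum_negf)
  then have "transpose (linear_form_matrix f) $ i $ j = (- linear_form_matrix f) $ i $ j" for i j
    unfolding transpose_def vec_lambda_beta vector_uminus_component .
  then show ?thesis
    unfolding skew_symmetric_def vec_eq_iff by blast
qed

lemma det_double_block: "det (double_block y) = (y $ 1 * y $ 4 - y $ 2 * y $ 3)\<^sup>2"
  by (simp add: det_4 det_3 double_block_def power2_eq_square algebra_simps)

text \<open>Cancelling \<open>R\<close> makes \<open>S\<close> equal to \<kappa> times
  \<open>R\<close>, so translation by a kernel vector \<open>v\<close> of its Gram matrix preserves
  the determinant form in \<open>y\<close>. That form is nondegenerate, which forces
  \<open>y v = 0\<close>.\<close>

lemma quadratic_rank_eq_CARD:
  fixes S R :: "'n::{finite,linorder} cpoly" and y :: "(complex, 'n) vec \<Rightarrow> complex^4"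
  assumes S: "homogeneous 2 S"
    and SR: "\<And>u. eval (($) u) S * eval (($) u) R = \<kappa> * (eval (($) u) R)\<^sup>2"
    and y: "\<And>u. eval (($) u) R = c * (y u $ 1 * y u $ 4 - y u $ 2 * y u $ 3)" "c \<noteq> 0" "\<kappa> \<noteq> 0"
    and add: "\<And>u v. y (u + v) = y u + y v" and surj: "surj y" and inj: "\<And>u. y u = 0 \<Longrightarrow> u = 0"
  shows "quadratic_rank S = CARD('n)"
  unfolding quadratic_rank_def
proof (rule rank_eq_CARD)
  fix v assume v: "gram_matrix S *v v = 0"
  have vec: "u = ($) (\<chi> k. u k)" for u :: "'n \<Rightarrow> complex"
    by (simp add: fun_eq_iff)
  \<comment> \<open>Here \<open>X\<close> is the identity, so \<open>R\<close> takes the nonzero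
    value \<open>c\<close> and can be cancelled.\<close>
  obtain u0 where u0: "y u0 = vector [1, 0, 0, 1]"
    using surj by (metis surjD)
  have "eval w S = eval w (Const \<kappa> * R)" for w
  proof (rule eval_cancel[of R _ _ "($) u0"])
    show "eval x R * eval x S = eval x R * eval x (Const \<kappa> * R)" for x
      using SR[of "\<chi> k. x k"] unfolding vec[symmetric] by (simp add: power2_eq_square ac_simps)
  qed (simp add: y u0)
  then have "eval (($) u) S = \<kappa> * eval (($) u) R" for u :: "(complex, 'n) vec"
    by simp
  then have "eval (($) (u + v)) R = eval (($) u) R" for u
    using eval_add_kernel[OF S v, of u] y(3) by simp
  then have "(y u + y v) $ 1 * (y u + y v) $ 4 - (y u + y v) $ 2 * (y u + y v) $ 3
      = y u $ 1 * y u $ 4 - y u $ 2 * y u $ 3" for u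
    using y(2) by (simp only: y(1) add mult_cancel_left simp_thms)
  note * = this
  have eq: "(z + y v) $ 1 * (z + y v) $ 4 - (z + y v) $ 2 * (z + y v) $ 3
      = z $ 1 * z $ 4 - z $ 2 * z $ 3" for z
  proof -
    obtain u where "z = y u" using surj by (rule surjE)
    with *[of u] show ?thesis by simp
  qed
  \<comment> \<open>Comparing the origin with each unit vector isolates one coordinate of
    \<open>y v\<close>.\<close>
  have "y v $ 4 = 0" "y v $ 3 = 0" "y v $ 2 = 0" "y v $ 1 = 0"
    using eq[of 0] eq[of "vector [1, 0, 0, 0]"] eq[of "vector [0, 1, 0, 0]"]
      eq[of "vector [0, 0, 1, 0]"] eq[of "vector [0, 0, 0, 1]"]
    by (auto simp: distrib_right distrib_left)
  then have "y v = 0"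
    by (simp add: vec_eq_iff forall_4)
  then show "v = 0" by (rule inj)
qed

section \<open>Classification of the spaces\<close>

theorem proposition11:
  fixes E :: "(complex^4^4) set"
    and e :: "'n::{finite,linorder} \<Rightarrow> complex^4^4"
    and S :: "'n cpoly"
  assumes "cmat.subspace E"
    and "is_basis e E"
    and "irreducible S"
    and "total_degree S = 2"
    and "\<And>(r :: 3 \<Rightarrow> 4) (s :: 3 \<Rightarrow> 4). inj r \<Longrightarrow> inj s \<Longrightarrow> S dvd minor r s (linear_form_matrix e)"
  shows "bounded_rank 3 E \<or>
    ((\<exists>L :: 'n cpoly^4^4. has_matrix_up_to_bases E L \<and> skew_symmetric L) \<or>
     (quadratic_rank S = 3 \<and>
        has_matrix_up_to_bases E (block_diag generic_symmetric_2x2 generic_symmetric_2x2)) \<or>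
     (quadratic_rank S = 4 \<and>
        has_matrix_up_to_bases E (block_diag generic_2x2 generic_2x2)))"
proof (cases "bounded_rank 3 E")
  case False
  let ?A = "linear_form_matrix e"
  have e: "range (pencil e) = E" "\<And>u. pencil e u = 0 \<Longrightarrow> u = 0"
    using \<open>is_basis e E\<close> by (simp_all add: is_basis_iff_pencil)
  \<comment> \<open>Ranks are at most 4, so a matrix of rank above 3 is invertible; it supplies the
    point \<open>x\<close> at which the pencil is normalized.\<close>
  obtain X where X: "X \<in> E" "\<not> rank X \<le> 3"
    using False unfolding bounded_rank_def by blast
  then have "det X \<noteq> 0"
    using rank_le_CARD[of X] by (intro rank_eq_CARD_imp_det) simp
  then obtain x where x: "det (pencil e x) \<noteq> 0"
    using X(1) e(1) by auto
  then have "det ?A \<noteq> 0"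
    by (auto simp flip: eval_det_linear_form_matrix)
  from linear_matrix_factorization[OF \<open>total_degree S = 2\<close> assms(5) this]
  obtain n R where AN: "?A ** linear_form_matrix n = mat R" and dA: "det ?A = S * R"
    and S: "homogeneous 2 S" and R: "homogeneous 2 R" "R \<noteq> 0"
    by blast
  define r where "r = (\<lambda>u :: (complex, 'n) vec. eval (($) u) R)"
  have en: "pencil e u ** pencil n u = mat (r u)" for u
  proof -
    have "(pencil e u ** pencil n u) $ i $ j = eval (($) u) ((?A ** linear_form_matrix n) $ i $ j)" for i j
      by (simp add: matrix_matrix_mult_def id_hom.insertion_sum eval_linear_form_matrix)
    then show ?thesis
      by (simp add: AN vec_eq_iff mat_def r_def)
  qed
  have de: "det (pencil e u) = eval (($) u) S * r u" for u
    by (simp add: r_def dA flip: eval_det_linear_form_matrix)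
  have rx: "r x \<noteq> 0"
    using x de by auto
  define C where "C = matrix_scale (1 / r x) (pencil n x)"
  have "pencil e x ** C = mat 1"
    using rx by (simp add: C_def matrix_scale_mult_right en matrix_scale_mat)
  then have C: "pencil e x ** C = mat 1" "C ** pencil e x = mat 1"
    by (simp_all add: matrix_left_right_inverse)
  \<comment> \<open>\<open>C\<close> makes the pencil the identity at \<open>x\<close>; the factor
    \<open>pencil e x\<close> and the division by \<open>r x\<close> keep the products
    \<open>M u ** N u\<close> scalar, with value 1 at \<open>x\<close>.\<close>
  define M N where "M = (\<lambda>u. C ** pencil e u)"
    and "N = (\<lambda>u. matrix_scale (1 / r x) (pencil n u ** pencil e x))"
  have lin: "clinear_map M" "clinear_map N"
    using clinear_map_pencil[of e] clinear_map_pencil[of n]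
    by (simp_all add: M_def N_def clinear_map_def matrix_algebra cmat.scale_right_distrib mult.commute)
  have MN: "M u ** N u = mat (r u / r x)" for u
  proof -
    have "M u ** N u = matrix_scale (1 / r x) (C ** (pencil e u ** pencil n u) ** pencil e x)"
      by (simp add: M_def N_def matrix_scale_mult_right matrix_mul_assoc)
    also have "\<dots> = mat (r u / r x)"
      by (simp add: en mat_mult_eq_scale matrix_scale_mult_left C matrix_scale_mat)
    finally show ?thesis .
  qed
  have np: "\<not> (\<forall>u. r u / r x = (\<Sum>k\<in>UNIV. a k * u $ k) * (\<Sum>k\<in>UNIV. b k * u $ k))" for a b
  proof
    assume *: "\<forall>u. r u / r x = (\<Sum>k\<in>UNIV. a k * u $ k) * (\<Sum>k\<in>UNIV. b k * u $ k)"
    have "eval u R = (\<Sum>k\<in>UNIV. (r x * a k) * u k) * (\<Sum>k\<in>UNIV. b k * u k)" for u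
    proof -
      have "($) (\<chi> k. u k) = u" by (simp add: fun_eq_iff)
      then have "eval u R / r x = (\<Sum>k\<in>UNIV. a k * u k) * (\<Sum>k\<in>UNIV. b k * u k)"
        using *[rule_format, of "\<chi> k. u k"] by (simp add: r_def)
      then have "eval u R = r x * (\<Sum>k\<in>UNIV. a k * u k) * (\<Sum>k\<in>UNIV. b k * u k)"
        using rx by (simp add: field_simps)
      then show ?thesis
        by (simp add: sum_distrib_left mult.assoc)
    qed
    then show False
      using factorized_form_not_product[OF \<open>irreducible S\<close> \<open>total_degree S = 2\<close> AN dA R(2,1),
          of "\<lambda>k. r x * a k" b] by blast
  qed
  have Mx: "M x = mat 1" "r x / r x = 1"
    using rx by (simp_all add: M_def C)
  have invC: "invertible C"
    using C invertible_def by blast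
  from lin MN Mx np show ?thesis
  proof (cases rule: clifford_normal_form)
    case (skew P P')
    \<comment> \<open>The basis \<open>e\<close> is kept: the left base change takes in the
      normalizing factor \<open>C\<close>, the right one the symplectic factor.\<close>
    let ?P = "P' ** C" and ?Q = "P ** symplectic_unit"
    have "invertible ?P" "invertible ?Q"
      using skew(1,2) invC invertible_symplectic_unit
      by (metis invertible_def invertible_mult)+
    moreover have "skew_symmetric (linear_form_matrix (\<lambda>k. ?P ** e k ** ?Q))"
    proof (rule skew_symmetric_linear_form_matrix)
      show "skew_symmetric (?P ** e k ** ?Q)" for k
        using skew(3)[of "axis k 1"] by (simp add: M_def pencil_axis matrix_mul_assoc)
    qed
    ultimately show ?thesis
      using \<open>is_basis e E\<close> unfolding has_matrix_up_to_bases_def by blast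
  next
    case (double P P' y)
    \<comment> \<open>The new basis of \<open>E\<close> consists of the preimages of the coordinate
      double blocks under \<open>Z \<mapsto> P' C Z P\<close>.\<close>
    define f where "f = (\<lambda>k. (pencil e x ** P) ** double_block (axis k 1) ** P')"
    have pf: "pencil f z = (pencil e x ** P) ** double_block z ** P'" for z
      unfolding f_def pencil_conj pencil_double_block ..
    have inv: "(P' ** C) ** ((pencil e x ** P) ** Z ** P') ** P = Z" for Z
    proof -
      have "(P' ** C) ** ((pencil e x ** P) ** Z ** P') ** P = P' ** (C ** pencil e x) ** P ** Z ** (P' ** P)"
        by (simp only: matrix_mul_assoc)
      then show ?thesis by (simp add: C double(2))
    qed
    have pe: "pencil e u = pencil f (y u)" for u
    proof -
      have "(pencil e x ** P) ** (P' ** M u ** P) ** P' = pencil e x ** (P ** P') ** C ** pencil e u ** (P ** P')"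
        by (simp only: M_def matrix_mul_assoc)
      then show ?thesis
        unfolding pf by (simp add: C double(1,3))
    qed
    have basis: "is_basis f E"
      unfolding is_basis_iff_pencil
    proof (intro conjI allI impI)
      fix z assume "pencil f z = 0"
      then have "double_block z = (P' ** C) ** 0 ** P"
        using inv[of "double_block z", folded pf] by simp
      also have "\<dots> = double_block 0"
        by (simp add: double_block_def vec_eq_iff forall_4 matrix_matrix_mult_def)
      finally show "z = 0" by (rule double_block_inj)
    next
      show "range (pencil f) = E"
        unfolding e(1)[symmetric] using \<open>surj y\<close> by (simp add: pe flip: image_image[of _ y])
    qed
    have "linear_form_matrix (\<lambda>k. (P' ** C) ** f k ** P) = block_diag generic_2x2 generic_2x2"
      unfolding f_def inv linear_form_matrix_double_block ..
    moreover have "invertible (P' ** C)" "invertible P"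
      using double(1,2) invC by (metis invertible_def invertible_mult)+
    ultimately have "has_matrix_up_to_bases E (block_diag generic_2x2 generic_2x2)"
      using basis unfolding has_matrix_up_to_bases_def by blast
    \<comment> \<open>\<open>det A = S R\<close> is a constant times \<open>(det X)\<^sup>2\<close>
      and \<open>R\<close> is a constant times \<open>det X\<close>, so \<open>S\<close> is a
      constant multiple of \<open>R\<close>.\<close>
    moreover have "quadratic_rank S = CARD('n)"
    proof (rule quadratic_rank_eq_CARD[OF S])
      have ry: "r u = r x * (y u $ 1 * y u $ 4 - y u $ 2 * y u $ 3)" for u
        using double(6)[of u] rx by (simp add: field_simps)
      show "eval (($) u) R = r x * (y u $ 1 * y u $ 4 - y u $ 2 * y u $ 3)" for u
        using ry[of u] unfolding r_def .
      have "det P * det P' = 1"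
        using double(1) by (metis det_I det_mul)
      moreover have "det (pencil e u) = det (pencil e x) * (det P * det P') * (y u $ 1 * y u $ 4 - y u $ 2 * y u $ 3)\<^sup>2" for u
        unfolding pe[of u] pf by (simp only: det_mul det_double_block ac_simps)
      ultimately have Sr: "eval (($) u) S * r u = det (pencil e x) * (y u $ 1 * y u $ 4 - y u $ 2 * y u $ 3)\<^sup>2" for u
        unfolding de[symmetric] by (metis mult.right_neutral)
      have rr: "(r u)\<^sup>2 = (r x)\<^sup>2 * (y u $ 1 * y u $ 4 - y u $ 2 * y u $ 3)\<^sup>2" for u
        by (simp only: ry[of u] power_mult_distrib)
      have "eval (($) u) S * r u = det (pencil e x) / (r x)\<^sup>2 * (r u)\<^sup>2" for u
        unfolding Sr rr[of u] using rx by simp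
      then show "eval (($) u) S * eval (($) u) R = det (pencil e x) / (r x)\<^sup>2 * (eval (($) u) R)\<^sup>2" for u
        unfolding r_def .
      show "y u = 0 \<Longrightarrow> u = 0" for u
        by (rule e(2)) (simp add: pe)
      show "r x \<noteq> 0" by (rule rx)
      show "det (pencil e x) / (r x)\<^sup>2 \<noteq> 0" using rx x by simp
      show "y (u + v) = y u + y v" for u v by (rule double(4))
      show "surj y" by (rule double(5))
    qed
    moreover have "CARD('n) = 4"
      using card_basis_unique[OF \<open>is_basis e E\<close> basis] by simp
    ultimately show ?thesis by simp
  qed
qed simp

end
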